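(* Let $p,q\in\mathbb{R}\setminus\{0\}$ and $s>0$. Then the map $(A,B)\mapsto\Phi_{p,q,s}(A,B)=\mathrm{Tr}[(A^{q/2}B^pA^{q/2})^s]$ is jointly concave on $\mathcal{P}_n\times\mathcal{P}_n$ for every $n$ if and only if $0<p\le 1$, $0<q\le 1$ and $0<s\le 1/(p+q)$.
   Context: $\mathcal{P}_n$ denotes the set of $n\times n$ positive definite complex matrices; $\Phi_{p,q,s}(A,B)=\mathrm{Tr}[(A^{q/2}B^pA^{q/2})^s]$. *)

theory Defs
  imports "Jordan_Normal_Form.Schur_Decomposition"
begin

definition mtrace :: "complex mat \<Rightarrow> complex" where
  "mtrace A = (\<Sum>i<dim_row A. A $$ (i, i))"

definition hermitian_mat :: "nat \<Rightarrow> complex mat \<Rightarrow> bool" where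
  "hermitian_mat n A \<longleftrightarrow> A \<in> carrier_mat n n \<and> mat_adjoint A = A"

definition pos_def_mat :: "nat \<Rightarrow> complex mat \<Rightarrow> bool" where
  "pos_def_mat n A \<longleftrightarrow> hermitian_mat n A \<and>
     (\<forall>v \<in> carrier_vec n. v \<noteq> 0\<^sub>v n \<longrightarrow> 0 < Re (conjugate v \<bullet> (A *\<^sub>v v)))"

definition unitary_mat :: "nat \<Rightarrow> complex mat \<Rightarrow> bool" where
  "unitary_mat n U \<longleftrightarrow> U \<in> carrier_mat n n \<and> U * mat_adjoint U = 1\<^sub>m n \<and> mat_adjoint U * U = 1\<^sub>m n"

text \<open>Real power A^r of a positive definite matrix via the spectral theorem:
  if A = U diag(d) U^* with U unitary and d > 0, then A^r = U diag(d^r) U^*.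
  (This is independent of the chosen diagonalisation; for positive definite A
  such a diagonalisation exists.)\<close>
definition mat_powr :: "complex mat \<Rightarrow> real \<Rightarrow> complex mat" where
  "mat_powr A r = (SOME B. \<exists>U (d :: real list).
      unitary_mat (dim_row A) U \<and> length d = dim_row A \<and> (\<forall>x \<in> set d. 0 < x) \<and>
      A = U * mk_diagonal (map complex_of_real d) * mat_adjoint U \<and>
      B = U * mk_diagonal (map (\<lambda>x. complex_of_real (x powr r)) d) * mat_adjoint U)"

text \<open>Phi_{p,q,s}(A,B) = Tr[(A^{q/2} B^p A^{q/2})^s]  (real for positive definite A, B).\<close>
definition Phi :: "real \<Rightarrow> real \<Rightarrow> real \<Rightarrow> complex mat \<Rightarrow> complex mat \<Rightarrow> real" where
  "Phi p q s A B =
     Re (mtrace (mat_powr (mat_powr A (q/2) * mat_powr B p * mat_powr A (q/2)) s))"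

definition jointly_concave_Phi :: "nat \<Rightarrow> real \<Rightarrow> real \<Rightarrow> real \<Rightarrow> bool" where
  "jointly_concave_Phi n p q s \<longleftrightarrow>
     (\<forall>A1 B1 A2 B2 (t :: real).
        pos_def_mat n A1 \<and> pos_def_mat n B1 \<and> pos_def_mat n A2 \<and> pos_def_mat n B2 \<and>
        0 \<le> t \<and> t \<le> 1 \<longrightarrow>
        t * Phi p q s A1 B1 + (1 - t) * Phi p q s A2 B2
          \<le> Phi p q s (complex_of_real t \<cdot>\<^sub>m A1 + complex_of_real (1 - t) \<cdot>\<^sub>m A2)
                       (complex_of_real t \<cdot>\<^sub>m B1 + complex_of_real (1 - t) \<cdot>\<^sub>m B2))"

end

theory Submission
  imports "HOL-Analysis.Analysis" Defs "Jordan_Normal_Form.Spectral_Radius"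
begin

text \<open>Sufficiency is Zhang's variational argument. With \<open>1/s = 1/s1 + 1/s2\<close> one has
  \<open>\<Phi>(A, B) = min\<^sub>Z (s/s1) Tr (Z\<^sup>* A\<^sup>q Z)\<^bsup>s1\<^esup> + (s/s2) Tr (Z\<^bsup>-1\<^esup> B\<^sup>p Z\<^bsup>-*\<^esup>)\<^bsup>s2\<^esup>\<close>,
  the inequality being a noncommutative Hoelder--Young inequality. For \<open>s2 = 1/p\<close> the hypothesis
  says \<open>s1 \<le> 1/q\<close>, and both terms are concave by Epstein's theorem. The latter follows from the
  variational formula \<open>Tr M\<^sup>r = max\<^sub>X r Tr (M X\<^bsup>r-1\<^esup>) - (r - 1) Tr X\<^sup>r\<close> (a minimum for \<open>r \<le> 1\<close>)
  and Lieb's concavity of \<open>Tr K\<^sup>* A\<^bsup>1-u\<^esup> K B\<^sup>u\<close>, which is an integral of parallel sums.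
  Necessity is seen on scalars, except for \<open>p, q \<le> 1\<close>, which needs \<open>2 \<times> 2\<close> matrices.\<close>

unbundle no vec_syntax

section \<open>Adjoints, traces and diagonal matrices\<close>

text \<open>The obstacle is that A and B do not commute and share one trace. The minimum over Z
  separates them: a minimiser for the mixed pair is a competitor at both endpoints, and only
  concavity in one variable remains. The value s2 = 1/p is extreme: Epstein's theorem allows s2 p <=
  1, and the largest such s2 leaves the largest share 1/s1 = 1/s - p to the term with A. The bound p
  <= 1 gives s2 >= 1, which keeps a weight in the Hoelder--Young argument nonnegative. That argument
  needs the Araki--Lieb--Thirring inequality when s > 1; this is obtained from Epstein's theorem
  itself, by pinching, so that all of sufficiency rests on one integral representation. No limits of
  matrices occur: the minimiser Z is explicit and invertible, and the counterexample for p > 1 uses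
  a small but positive eigenvalue.\<close>

lemma adj_carrier [simp, intro]: "A \<in> carrier_mat n m \<Longrightarrow> mat_adjoint A \<in> carrier_mat m n"
  unfolding mat_adjoint_def by auto

lemma adj_index [simp]:
  "i < dim_col A \<Longrightarrow> j < dim_row A \<Longrightarrow> mat_adjoint (A :: complex mat) $$ (i, j) = cnj (A $$ (j, i))"
  unfolding mat_adjoint_def by (simp add: mat_of_rows_index conjugate_complex_def)

lemma adj_dim [simp]:
  "dim_row (mat_adjoint A) = dim_col A" "dim_col (mat_adjoint A) = dim_row A"
  unfolding mat_adjoint_def by auto

lemma mult_index:
  assumes "A \<in> carrier_mat n m" "B \<in> carrier_mat m l" "i < n" "j < l"
  shows "(A * B) $$ (i, j) = (\<Sum>k<m. A $$ (i, k) * B $$ (k, j))"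
  using assms by (auto simp: scalar_prod_def atLeast0LessThan intro!: sum.cong)

lemma adj_adj [simp]: "mat_adjoint (mat_adjoint (A :: complex mat)) = A"
  by (rule eq_matI) auto

lemma adj_one [simp]: "mat_adjoint (1\<^sub>m n :: complex mat) = 1\<^sub>m n"
  by (rule eq_matI) auto

lemma adj_mult:
  fixes A B :: "complex mat"
  assumes "A \<in> carrier_mat n m" "B \<in> carrier_mat m l"
  shows "mat_adjoint (A * B) = mat_adjoint B * mat_adjoint A"
proof (rule eq_matI)
  fix i j
  assume "i < dim_row (mat_adjoint B * mat_adjoint A)" "j < dim_col (mat_adjoint B * mat_adjoint A)"
  then have ij: "i < l" "j < n" using assms by auto
  have "mat_adjoint (A * B) $$ (i, j) = cnj ((A * B) $$ (j, i))" using assms ij by simp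
  also have "\<dots> = (\<Sum>k<m. mat_adjoint B $$ (i, k) * mat_adjoint A $$ (k, j))"
    using assms ij by (auto simp: mult_index[OF assms] mult.commute simp del: index_mult_mat(1) intro!: sum.cong)
  also have "\<dots> = (mat_adjoint B * mat_adjoint A) $$ (i, j)"
    by (rule mult_index[symmetric, of _ _ _ _ n]) (use assms ij in auto)
  finally show "mat_adjoint (A * B) $$ (i, j) = (mat_adjoint B * mat_adjoint A) $$ (i, j)" .
qed (use assms in auto)

lemma adj_add:
  fixes A B :: "complex mat"
  assumes "A \<in> carrier_mat n m" "B \<in> carrier_mat n m"
  shows "mat_adjoint (A + B) = mat_adjoint A + mat_adjoint B"
  by (rule eq_matI) (use assms in auto)

lemma adj_smult: "mat_adjoint (c \<cdot>\<^sub>m (A :: complex mat)) = cnj c \<cdot>\<^sub>m mat_adjoint A"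
  by (rule eq_matI) auto

text \<open>Indexing by functions instead of lists makes products and powers of diagonal matrices
  pointwise. The list form in \<open>mat_powr\<close> is translated by
  \<open>mk_diagonal_real_diag\<close>.\<close>

definition real_diag :: "nat \<Rightarrow> (nat \<Rightarrow> real) \<Rightarrow> complex mat" where
  "real_diag n f = mat n n (\<lambda>(i, j). if i = j then complex_of_real (f i) else 0)"

lemma real_diag_carrier [simp]: "real_diag n f \<in> carrier_mat n n"
  by (simp add: real_diag_def)

lemma real_diag_index [simp]: "i < n \<Longrightarrow> j < n \<Longrightarrow> real_diag n f $$ (i, j) = (if i = j then complex_of_real (f i) else 0)"
  by (simp add: real_diag_def)

lemma real_diag_dim [simp]: "dim_row (real_diag n f) = n" "dim_col (real_diag n f) = n"
  by (simp_all add: real_diag_def)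

lemma real_diag_cong: "(\<And>i. i < n \<Longrightarrow> f i = g i) \<Longrightarrow> real_diag n f = real_diag n g"
  by (rule eq_matI) auto

lemma adj_real_diag [simp]: "mat_adjoint (real_diag n f) = real_diag n f"
  by (rule eq_matI) auto

lemma real_diag_one: "real_diag n (\<lambda>_. 1) = 1\<^sub>m n"
  by (rule eq_matI) auto

lemma real_diag_mult_index:
  assumes "A \<in> carrier_mat n m" "i < n" "j < m"
  shows "(real_diag n f * A) $$ (i, j) = complex_of_real (f i) * A $$ (i, j)"
proof -
  have "(real_diag n f * A) $$ (i, j) = (\<Sum>k<n. real_diag n f $$ (i, k) * A $$ (k, j))"
    by (rule mult_index) (use assms in auto)
  also have "\<dots> = (\<Sum>k<n. if i = k then complex_of_real (f i) * A $$ (i, j) else 0)"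
    using assms by (intro sum.cong) auto
  finally show ?thesis using assms by simp
qed

lemma mult_real_diag_index:
  assumes "A \<in> carrier_mat m n" "i < m" "j < n"
  shows "(A * real_diag n f) $$ (i, j) = A $$ (i, j) * complex_of_real (f j)"
proof -
  have "(A * real_diag n f) $$ (i, j) = (\<Sum>k<n. A $$ (i, k) * real_diag n f $$ (k, j))"
    by (rule mult_index) (use assms in auto)
  also have "\<dots> = (\<Sum>k<n. if j = k then A $$ (i, j) * complex_of_real (f j) else 0)"
    using assms by (intro sum.cong) auto
  finally show ?thesis using assms by simp
qed

lemma real_diag_mult: "real_diag n f * real_diag n g = real_diag n (\<lambda>i. f i * g i)"
  by (rule eq_matI) (auto simp: real_diag_mult_index[of _ n n] simp del: index_mult_mat(1))

text \<open>The real part matches \<open>Phi\<close> and spares separate proofs that the traces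
  below are real; linearity over real scalars and cyclicity survive.\<close>

definition re_trace :: "complex mat \<Rightarrow> real" where
  "re_trace A = Re (mtrace A)"

lemma re_trace_sum: "A \<in> carrier_mat n n \<Longrightarrow> re_trace A = (\<Sum>i<n. Re (A $$ (i, i)))"
  by (auto simp: re_trace_def mtrace_def)

lemma re_trace_real_diag: "re_trace (real_diag n f) = (\<Sum>i<n. f i)"
  by (simp add: re_trace_sum[of _ n])

lemma re_trace_comm:
  assumes "A \<in> carrier_mat n m" "B \<in> carrier_mat m n"
  shows "re_trace (A * B) = re_trace (B * A)"
proof -
  have "mtrace (A * B) = (\<Sum>i<n. \<Sum>k<m. A $$ (i, k) * B $$ (k, i))"
    using assms by (auto simp: mtrace_def mult_index[OF assms] simp del: index_mult_mat(1) intro!: sum.cong)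
  also have "\<dots> = (\<Sum>k<m. \<Sum>i<n. B $$ (k, i) * A $$ (i, k))"
    by (subst sum.swap) (simp add: mult.commute)
  also have "\<dots> = mtrace (B * A)"
    using assms by (auto simp: mtrace_def mult_index[OF assms(2,1)] simp del: index_mult_mat(1) intro!: sum.cong)
  finally show ?thesis by (simp add: re_trace_def)
qed

lemma re_trace_add: "A \<in> carrier_mat n n \<Longrightarrow> B \<in> carrier_mat n n \<Longrightarrow> re_trace (A + B) = re_trace A + re_trace B"
  by (simp add: re_trace_sum[of _ n] sum.distrib)

lemma re_trace_smult: "A \<in> carrier_mat n n \<Longrightarrow> re_trace (complex_of_real c \<cdot>\<^sub>m A) = c * re_trace A"
  by (simp add: re_trace_sum[of _ n] sum_distrib_left)

lemma assoc3:
  assumes "A \<in> carrier_mat n n" "B \<in> carrier_mat n n" "C \<in> carrier_mat n n"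
  shows "A * B * C = A * (B * C)"
  using assms by (rule assoc_mult_mat)

lemma carrier_mult: "A \<in> carrier_mat n n \<Longrightarrow> B \<in> carrier_mat n n \<Longrightarrow> A * B \<in> carrier_mat n n"
  by simp

lemma cancel_left:
  fixes A B C :: "complex mat"
  assumes "A * B = 1\<^sub>m n" "A \<in> carrier_mat n n" "B \<in> carrier_mat n n" "C \<in> carrier_mat n n"
  shows "A * (B * C) = C"
  using assms by (simp flip: assoc_mult_mat[of A n n B n C n] add: left_mult_one_mat[of C n n])

lemma right_inverse_commute:
  fixes A B :: "complex mat"
  assumes "A * B = 1\<^sub>m n" "A \<in> carrier_mat n n" "B \<in> carrier_mat n n"
  shows "B * A = 1\<^sub>m n"
  using mat_mult_left_right_inverse[OF assms(2,3,1)] .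

section \<open>Unitary matrices\<close>

lemma unitary_carrier: "unitary_mat n U \<Longrightarrow> U \<in> carrier_mat n n"
  by (simp add: unitary_mat_def)

lemma unitary_left: "unitary_mat n U \<Longrightarrow> mat_adjoint U * U = 1\<^sub>m n"
  by (simp add: unitary_mat_def)

lemma unitary_right: "unitary_mat n U \<Longrightarrow> U * mat_adjoint U = 1\<^sub>m n"
  by (simp add: unitary_mat_def)

lemma unitaryI: "U \<in> carrier_mat n n \<Longrightarrow> mat_adjoint U * U = 1\<^sub>m n \<Longrightarrow> unitary_mat n U"
  using right_inverse_commute[of "mat_adjoint U" U n] by (simp add: unitary_mat_def)

lemma unitary_adj: "unitary_mat n U \<Longrightarrow> unitary_mat n (mat_adjoint U)"
  by (simp add: unitary_mat_def)

lemma unitary_one: "unitary_mat n (1\<^sub>m n)"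
  by (simp add: unitary_mat_def)

lemma unitary_mult:
  assumes "unitary_mat n U" "unitary_mat n V"
  shows "unitary_mat n (U * V)"
proof (rule unitaryI)
  note c = unitary_carrier[OF assms(1)] unitary_carrier[OF assms(2)]
  show "U * V \<in> carrier_mat n n" using c by simp
  have "mat_adjoint (U * V) * (U * V) = mat_adjoint V * (mat_adjoint U * (U * V))"
    using c by (simp add: adj_mult[of _ n n _ n] assoc3[of _ n] carrier_mult)
  also have "\<dots> = 1\<^sub>m n"
    using c by (simp add: cancel_left[of _ _ n] unitary_left assms)
  finally show "mat_adjoint (U * V) * (U * V) = 1\<^sub>m n" .
qed

section \<open>The spectral theorem\<close>

text \<open>The block matrix diag(c, X). It carries the step from dimension m to m + 1 in the
  spectral theorem, with \<open>case_nat\<close> doing the same for the eigenvalues.\<close>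

definition border :: "nat \<Rightarrow> complex \<Rightarrow> complex mat \<Rightarrow> complex mat" where
  "border m c X = mat (Suc m) (Suc m) (\<lambda>(i, j). case i of
       0 \<Rightarrow> (case j of 0 \<Rightarrow> c | Suc _ \<Rightarrow> 0)
     | Suc i' \<Rightarrow> (case j of 0 \<Rightarrow> 0 | Suc j' \<Rightarrow> X $$ (i', j')))"

lemma border_carrier [simp]: "border m c X \<in> carrier_mat (Suc m) (Suc m)"
  by (simp add: border_def)

lemma border_dim [simp]: "dim_row (border m c X) = Suc m" "dim_col (border m c X) = Suc m"
  by (simp_all add: border_def)

lemma border_index [simp]:
  "border m c X $$ (0, 0) = c"
  "j < m \<Longrightarrow> border m c X $$ (0, Suc j) = 0"
  "i < m \<Longrightarrow> border m c X $$ (Suc i, 0) = 0"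
  "i < m \<Longrightarrow> j < m \<Longrightarrow> border m c X $$ (Suc i, Suc j) = X $$ (i, j)"
  by (simp_all add: border_def)

lemma border_mult:
  assumes "X \<in> carrier_mat m m" "Y \<in> carrier_mat m m"
  shows "border m c X * border m d Y = border m (c * d) (X * Y)"
proof (rule eq_matI)
  fix i j
  assume "i < dim_row (border m (c * d) (X * Y))" "j < dim_col (border m (c * d) (X * Y))"
  then have ij: "i < Suc m" "j < Suc m" by auto
  have "(border m c X * border m d Y) $$ (i, j) = (\<Sum>k<Suc m. border m c X $$ (i, k) * border m d Y $$ (k, j))"
    by (rule mult_index) (use ij in auto)
  also have "\<dots> = border m (c * d) (X * Y) $$ (i, j)"
    using ij
    by (cases i; cases j)
      (simp_all add: sum.lessThan_Suc_shift mult_index[OF assms] del: index_mult_mat(1) sum.lessThan_Suc)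
  finally show "(border m c X * border m d Y) $$ (i, j) = border m (c * d) (X * Y) $$ (i, j)" .
qed auto

lemma adj_border:
  assumes "X \<in> carrier_mat m m"
  shows "mat_adjoint (border m c X) = border m (cnj c) (mat_adjoint X)"
proof (rule eq_matI)
  fix i j
  assume "i < dim_row (border m (cnj c) (mat_adjoint X))" "j < dim_col (border m (cnj c) (mat_adjoint X))"
  then show "mat_adjoint (border m c X) $$ (i, j) = border m (cnj c) (mat_adjoint X) $$ (i, j)"
    using assms by (cases i; cases j) auto
qed auto

lemma border_one: "border m 1 (1\<^sub>m m) = 1\<^sub>m (Suc m)"
proof (rule eq_matI)
  fix i j
  assume "i < dim_row (1\<^sub>m (Suc m) :: complex mat)" "j < dim_col (1\<^sub>m (Suc m) :: complex mat)"
  then show "border m 1 (1\<^sub>m m) $$ (i, j) = 1\<^sub>m (Suc m) $$ (i, j)"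
    by (cases i; cases j) auto
qed auto

lemma border_real_diag: "border m (complex_of_real e) (real_diag m d) = real_diag (Suc m) (case_nat e d)"
proof (rule eq_matI)
  fix i j
  assume "i < dim_row (real_diag (Suc m) (case_nat e d))" "j < dim_col (real_diag (Suc m) (case_nat e d))"
  then show "border m (complex_of_real e) (real_diag m d) $$ (i, j) = real_diag (Suc m) (case_nat e d) $$ (i, j)"
    by (cases i; cases j) auto
qed auto

text \<open>Completing v to a basis and orthogonalising keeps v as the first vector. Dividing the
  columns by their norms makes them orthonormal; c is the factor of the first column.\<close>

lemma unitary_first_column:
  fixes v :: "complex vec"
  assumes v: "v \<in> carrier_vec n" "v \<noteq> 0\<^sub>v n"
  obtains W c where "unitary_mat n W" "\<And>i. i < n \<Longrightarrow> W $$ (i, 0) = c * v $ i"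
proof -
  interpret cof_vec_space n "TYPE(complex)" .
  note bc = basis_completion[OF v]
  define ws where "ws = gram_schmidt n (basis_completion v)"
  note gs = gram_schmidt_result[OF bc(2) bc(4) bc(5) ws_def]
  have len: "length ws = n" using gs(4) bc(6) by simp
  have n0: "0 < n" using v by (cases "n = 0") auto
  have hd: "ws ! 0 = v"
  proof -
    obtain w ws' where w: "basis_completion v = w # ws'" using bc(6) n0 by (cases "basis_completion v") auto
    have "hd ws = v"
      unfolding ws_def w using bc(7) w v by (simp add: gram_schmidt_hd)
    then show ?thesis using len n0 by (cases ws) auto
  qed
  have wc: "ws ! j \<in> carrier_vec n" if "j < n" for j using gs(3) len that by auto
  define N where "N j = (\<Sum>i<n. (cmod (ws ! j $ i))\<^sup>2)" for j
  have sp: "ws ! j \<bullet>c ws ! k = (\<Sum>i<n. (ws ! j $ i) * cnj (ws ! k $ i))" if "j < n" "k < n" for j k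
    using wc[OF that(1)] wc[OF that(2)] by (auto simp: scalar_prod_def atLeast0LessThan conjugate_complex_def intro!: sum.cong)
  have spN: "ws ! j \<bullet>c ws ! j = complex_of_real (N j)" if "j < n" for j
    using that unfolding sp[OF that that] N_def of_real_sum by (intro sum.cong refl) (simp only: complex_norm_square)
  have orth: "ws ! j \<bullet>c ws ! k = 0 \<longleftrightarrow> j \<noteq> k" if "j < n" "k < n" for j k
    using corthogonalD[OF gs(2)] len that by simp
  have Npos: "N j > 0" if "j < n" for j
  proof -
    have "N j \<noteq> 0" using spN[OF that] orth[OF that that] by auto
    moreover have "N j \<ge> 0" unfolding N_def by (simp add: sum_nonneg)
    ultimately show ?thesis by simp
  qed
  define W where "W = mat n n (\<lambda>(i, j). complex_of_real (1 / sqrt (N j)) * ws ! j $ i)"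
  have W: "W \<in> carrier_mat n n" by (simp add: W_def)
  have "mat_adjoint W * W = 1\<^sub>m n"
  proof (rule eq_matI)
    fix i j assume "i < dim_row (1\<^sub>m n :: complex mat)" "j < dim_col (1\<^sub>m n :: complex mat)"
    then have ij: "i < n" "j < n" by auto
    have "(mat_adjoint W * W) $$ (i, j) = (\<Sum>k<n. mat_adjoint W $$ (i, k) * W $$ (k, j))"
      by (rule mult_index) (use W ij in auto)
    also have "\<dots> = (\<Sum>k<n. complex_of_real (1 / sqrt (N i) * (1 / sqrt (N j))) * (ws ! j $ k * cnj (ws ! i $ k)))"
      using ij W by (intro sum.cong) (auto simp: W_def)
    also have "\<dots> = complex_of_real (1 / sqrt (N i) * (1 / sqrt (N j))) * (ws ! j \<bullet>c ws ! i)"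
      using ij by (simp add: sp sum_distrib_left)
    also have "\<dots> = (if i = j then 1 else 0)"
    proof (cases "i = j")
      case True
      have "1 / sqrt (N j) * (1 / sqrt (N j)) * N j = 1"
        using Npos[OF ij(2)] by simp
      then show ?thesis using True spN[OF ij(2)] by (metis of_real_1 of_real_mult)
    next
      case False
      then show ?thesis using orth[OF ij(2,1)] by auto
    qed
    finally show "(mat_adjoint W * W) $$ (i, j) = 1\<^sub>m n $$ (i, j)" using ij by simp
  qed (use W in auto)
  then have "unitary_mat n W" using W by (simp add: unitaryI)
  moreover have "W $$ (i, 0) = complex_of_real (1 / sqrt (N 0)) * v $ i" if "i < n" for i
    using that n0 by (simp add: W_def hd)
  ultimately show ?thesis using that by blast
qed

text \<open>Deflation: in an orthonormal basis that starts with an eigenvector, the first column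
  vanishes below the diagonal, and self-adjointness clears the first row too. What remains is a
  hermitian block of size m.\<close>

lemma hermitian_spectral:
  assumes "hermitian_mat n A"
  shows "\<exists>U d. unitary_mat n U \<and> A = U * real_diag n d * mat_adjoint U"
  using assms
proof (induction n arbitrary: A)
  case 0
  have "A = 1\<^sub>m 0 * real_diag 0 (\<lambda>_. 1) * mat_adjoint (1\<^sub>m 0)"
    using 0 by (intro eq_matI) (auto simp: hermitian_mat_def)
  then show ?case using unitary_one by blast
next
  case (Suc m)
  let ?n = "Suc m"
  have A: "A \<in> carrier_mat ?n ?n" "mat_adjoint A = A" using Suc.prems by (auto simp: hermitian_mat_def)
  obtain e where "e \<in> spectrum A" using spectrum_non_empty[OF A(1)] by auto
  then obtain v where v: "v \<in> carrier_vec ?n" "v \<noteq> 0\<^sub>v ?n" "A *\<^sub>v v = e \<cdot>\<^sub>v v"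
    using A by (auto simp: spectrum_def eigenvalue_def eigenvector_def)
  obtain W c where W: "unitary_mat ?n W" "\<And>i. i < ?n \<Longrightarrow> W $$ (i, 0) = c * v $ i"
    using unitary_first_column[OF v(1,2)] by metis
  have Wc: "W \<in> carrier_mat ?n ?n" using W(1) by (rule unitary_carrier)
  have AW: "(A * W) $$ (i, 0) = e * W $$ (i, 0)" if i: "i < ?n" for i
  proof -
    have "(A * W) $$ (i, 0) = (\<Sum>k<?n. A $$ (i, k) * W $$ (k, 0))"
      by (rule mult_index) (use A Wc i in auto)
    also have "\<dots> = c * (\<Sum>k<?n. A $$ (i, k) * v $ k)"
      unfolding sum_distrib_left by (intro sum.cong) (auto simp: W(2))
    also have "(\<Sum>k<?n. A $$ (i, k) * v $ k) = (A *\<^sub>v v) $ i"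
      using A v(1) i by (auto simp: scalar_prod_def atLeast0LessThan simp del: sum.lessThan_Suc intro!: sum.cong)
    also have "\<dots> = e * v $ i" using v i by (simp only: v(3)) simp
    finally show ?thesis unfolding W(2)[OF i] by (simp only: mult.left_commute)
  qed
  define B where "B = mat_adjoint W * (A * W)"
  have Bc: "B \<in> carrier_mat ?n ?n" unfolding B_def using A Wc by auto
  have Badj: "mat_adjoint B = B" unfolding B_def
    using A Wc by (simp add: adj_mult[of _ ?n ?n _ ?n] assoc3[of _ ?n] carrier_mult)
  have B0: "B $$ (i, 0) = (if i = 0 then e else 0)" if i: "i < ?n" for i
  proof -
    have "B $$ (i, 0) = (\<Sum>k<?n. mat_adjoint W $$ (i, k) * (A * W) $$ (k, 0))"
      unfolding B_def by (rule mult_index) (use A Wc i in auto)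
    also have "\<dots> = e * (\<Sum>k<?n. mat_adjoint W $$ (i, k) * W $$ (k, 0))"
      unfolding sum_distrib_left by (intro sum.cong) (auto simp: AW simp del: index_mult_mat(1))
    also have "(\<Sum>k<?n. mat_adjoint W $$ (i, k) * W $$ (k, 0)) = (mat_adjoint W * W) $$ (i, 0)"
      by (rule mult_index[symmetric]) (use Wc i in auto)
    finally show ?thesis using i by (simp add: unitary_left[OF W(1)])
  qed
  have Bsym: "B $$ (i, j) = cnj (B $$ (j, i))" if "i < ?n" "j < ?n" for i j
    using adj_index[of i B j] Badj Bc that by simp
  have ereal: "e = complex_of_real (Re e)"
    using Bsym[of 0 0] B0[of 0] by (simp add: complex_eq_iff)
  define B3 where "B3 = mat m m (\<lambda>(i, j). B $$ (Suc i, Suc j))"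
  have B3: "hermitian_mat m B3"
    unfolding hermitian_mat_def
  proof
    show "mat_adjoint B3 = B3"
    proof (rule eq_matI)
      fix i j assume "i < dim_row B3" "j < dim_col B3"
      then have ij: "i < m" "j < m" by (auto simp: B3_def)
      show "mat_adjoint B3 $$ (i, j) = B3 $$ (i, j)"
        using ij Bsym[of "Suc i" "Suc j"] by (simp add: B3_def)
    qed (auto simp: B3_def)
  qed (auto simp: B3_def)
  have Bb: "B = border m (complex_of_real (Re e)) B3"
  proof (rule eq_matI)
    fix i j assume "i < dim_row (border m (complex_of_real (Re e)) B3)" "j < dim_col (border m (complex_of_real (Re e)) B3)"
    then show "B $$ (i, j) = border m (complex_of_real (Re e)) B3 $$ (i, j)"
      using B0 Bsym[of i j] ereal by (cases i; cases j) (auto simp: B3_def)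
  qed (use Bc in auto)
  obtain U d where U: "unitary_mat m U" "B3 = U * real_diag m d * mat_adjoint U"
    using Suc.IH[OF B3] by auto
  note Uc = unitary_carrier[OF U(1)]
  define V where "V = border m 1 U"
  have V: "unitary_mat ?n V"
    unfolding V_def using Uc
    by (intro unitaryI) (auto simp: adj_border border_mult[of _ m] unitary_left[OF U(1)] border_one)
  note Vc = unitary_carrier[OF V]
  have BV: "B = V * real_diag ?n (case_nat (Re e) d) * mat_adjoint V"
    unfolding Bb U(2) V_def border_real_diag[symmetric] using Uc
    by (simp add: adj_border border_mult[of _ m] carrier_mult)
  have "A = W * B * mat_adjoint W"
    unfolding B_def using A Wc
    by (simp add: assoc3[of _ ?n] carrier_mult cancel_left[of W _ ?n] unitary_right[OF W(1)])
  also have "\<dots> = (W * V) * real_diag ?n (case_nat (Re e) d) * mat_adjoint (W * V)"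
    unfolding BV using Wc Vc
    by (simp add: assoc3[of _ ?n] carrier_mult adj_mult[of _ ?n ?n _ ?n])
  finally show ?case using unitary_mult[OF W(1) V] by blast
qed

section \<open>Positive definite matrices and their powers\<close>

lemma mk_diagonal_real_diag:
  "mk_diagonal (map (\<lambda>x. complex_of_real (f x)) d) = real_diag (length d) (\<lambda>i. f (d ! i))"
proof (induction d)
  case Nil
  show ?case by (rule eq_matI) (auto simp: mk_diagonal_def)
next
  case (Cons a d)
  show ?case
  proof (rule eq_matI)
    fix i j
    assume "i < dim_row (real_diag (length (a # d)) (\<lambda>i. f ((a # d) ! i)))"
      and "j < dim_col (real_diag (length (a # d)) (\<lambda>i. f ((a # d) ! i)))"
    then show "mk_diagonal (map (\<lambda>x. complex_of_real (f x)) (a # d)) $$ (i, j)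
        = real_diag (length (a # d)) (\<lambda>i. f ((a # d) ! i)) $$ (i, j)"
      using Cons.IH mk_diagonal_dim[of "map (\<lambda>x. complex_of_real (f x)) d"]
      by (cases i; cases j) (auto simp: mk_diagonal_def Let_def o_def)
  qed (auto simp: mk_diagonal_dim simp del: list.map)
qed

text \<open>The matrix W = V^* U intertwines the two diagonal matrices, so its entry (i, j) can be
  nonzero only if d j = e i, and then f (d j) = f (e i). Hence W intertwines the images under f as
  well.\<close>

lemma spectral_unique:
  assumes U: "unitary_mat n U" and V: "unitary_mat n V"
    and eq: "U * real_diag n d * mat_adjoint U = V * real_diag n e * mat_adjoint V"
  shows "U * real_diag n (\<lambda>i. f (d i)) * mat_adjoint U = V * real_diag n (\<lambda>i. f (e i)) * mat_adjoint V"
proof -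
  note c = unitary_carrier[OF U] unitary_carrier[OF V]
  note s = assoc3[of _ n] carrier_mult cancel_left[of _ _ n] unitary_left[OF U] unitary_right[OF U]
    unitary_left[OF V] unitary_right[OF V]
  define W where "W = mat_adjoint V * U"
  have W: "W \<in> carrier_mat n n" using c by (auto simp: W_def)
  have "W * real_diag n d = mat_adjoint V * (U * real_diag n d * mat_adjoint U) * U"
    unfolding W_def using c by (simp add: s)
  also have "\<dots> = real_diag n e * W"
    unfolding eq W_def using c by (simp add: s)
  finally have com: "W * real_diag n d = real_diag n e * W" .
  have comf: "W * real_diag n (\<lambda>i. f (d i)) = real_diag n (\<lambda>i. f (e i)) * W"
  proof (rule eq_matI)
    fix i j assume "i < dim_row (real_diag n (\<lambda>i. f (e i)) * W)" "j < dim_col (real_diag n (\<lambda>i. f (e i)) * W)"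
    then have ij: "i < n" "j < n" using W by auto
    have "W $$ (i, j) * complex_of_real (d j) = complex_of_real (e i) * W $$ (i, j)"
      using arg_cong[OF com, of "\<lambda>X. X $$ (i, j)"] ij W
      by (simp add: real_diag_mult_index[of _ n n] mult_real_diag_index[of _ n n] del: index_mult_mat(1))
    then have "W $$ (i, j) = 0 \<or> d j = e i" by auto
    then show "(W * real_diag n (\<lambda>i. f (d i))) $$ (i, j) = (real_diag n (\<lambda>i. f (e i)) * W) $$ (i, j)"
      using ij W by (auto simp add: real_diag_mult_index[of _ n n] mult_real_diag_index[of _ n n] simp del: index_mult_mat(1))
  qed (use W in auto)
  have "U * real_diag n (\<lambda>i. f (d i)) * mat_adjoint U = V * (W * real_diag n (\<lambda>i. f (d i))) * mat_adjoint U"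
    unfolding W_def using c by (simp add: s)
  also have "\<dots> = V * real_diag n (\<lambda>i. f (e i)) * mat_adjoint V"
    unfolding comf unfolding W_def using c by (simp add: s)
  finally show ?thesis .
qed

text \<open>A spectral decomposition kept as a relation, with positive eigenvalues built in, so that
  facts about powers can be proved in any convenient eigenbasis instead of the one picked by
  \<open>SOME\<close>.\<close>

definition eig :: "nat \<Rightarrow> complex mat \<Rightarrow> complex mat \<Rightarrow> (nat \<Rightarrow> real) \<Rightarrow> bool" where
  "eig n A U d \<longleftrightarrow> unitary_mat n U \<and> (\<forall>i<n. 0 < d i) \<and> A = U * real_diag n d * mat_adjoint U"

lemma eigD:
  assumes "eig n A U d"
  shows "unitary_mat n U" "\<And>i. i < n \<Longrightarrow> 0 < d i" "A = U * real_diag n d * mat_adjoint U"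
    "U \<in> carrier_mat n n" "A \<in> carrier_mat n n"
  using assms by (auto simp: eig_def unitary_carrier intro!: mult_carrier_mat[of _ n n])

text \<open>The given decomposition shows that the choice in \<open>mat_powr\<close> has a witness;
  whatever is chosen agrees with it by \<open>spectral_unique\<close>.\<close>

lemma mat_powr_eig:
  assumes "eig n A U d"
  shows "mat_powr A r = U * real_diag n (\<lambda>i. d i powr r) * mat_adjoint U"
proof -
  note e = eigD[OF assms]
  have dr: "dim_row A = n" using e(5) by auto
  let ?P = "\<lambda>B. \<exists>U (d :: real list).
      unitary_mat (dim_row A) U \<and> length d = dim_row A \<and> (\<forall>x \<in> set d. 0 < x) \<and>
      A = U * mk_diagonal (map complex_of_real d) * mat_adjoint U \<and>
      B = U * mk_diagonal (map (\<lambda>x. complex_of_real (x powr r)) d) * mat_adjoint U"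
  let ?d = "map d [0..<n]"
  have "mk_diagonal (map (\<lambda>x. complex_of_real (f x)) ?d) = real_diag n (\<lambda>i. f (d i))" for f
    unfolding mk_diagonal_real_diag by (rule eq_matI) auto
  from this[of "\<lambda>x. x"] this[of "\<lambda>x. x powr r"]
  have real_diag1: "mk_diagonal (map complex_of_real ?d) = real_diag n d"
    and real_diag2: "mk_diagonal (map (\<lambda>x. complex_of_real (x powr r)) ?d) = real_diag n (\<lambda>i. d i powr r)"
    by simp_all
  have "?P (U * real_diag n (\<lambda>i. d i powr r) * mat_adjoint U)"
    by (rule exI[of _ U], rule exI[of _ ?d]) (use e dr real_diag1 real_diag2 in auto)
  then have "?P (mat_powr A r)" unfolding mat_powr_def by (rule someI[where P = ?P])
  then obtain V l where V: "unitary_mat n V" "length l = n"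
      "A = V * mk_diagonal (map complex_of_real l) * mat_adjoint V"
      "mat_powr A r = V * mk_diagonal (map (\<lambda>x. complex_of_real (x powr r)) l) * mat_adjoint V"
    unfolding dr by auto
  have "A = V * real_diag n (\<lambda>i. l ! i) * mat_adjoint V"
    using V(2,3) mk_diagonal_real_diag[of "\<lambda>x. x" l] by simp
  moreover have "mat_powr A r = V * real_diag n (\<lambda>i. l ! i powr r) * mat_adjoint V"
    using V(2,4) mk_diagonal_real_diag[of "\<lambda>x. x powr r" l] by simp
  ultimately show ?thesis
    using spectral_unique[OF V(1) e(1), of "\<lambda>i. l ! i" d "\<lambda>x. x powr r"] e(3) by simp
qed

lemma quadform_col:
  fixes A X :: "complex mat"
  assumes "A \<in> carrier_mat n n" "X \<in> carrier_mat n n" "i < n"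
  shows "conjugate (col X i) \<bullet> (A *\<^sub>v col X i) = (mat_adjoint X * (A * X)) $$ (i, i)"
proof -
  have "row (mat_adjoint X) i = conjugate (col X i)"
    using assms by (intro eq_vecI) (auto simp: conjugate_complex_def)
  moreover have "col (A * X) i = A *\<^sub>v col X i"
    using assms by (intro eq_vecI) auto
  ultimately show ?thesis using assms by simp
qed

lemma conjugate_mult_adj:
  fixes K :: "complex mat"
  assumes "K \<in> carrier_mat n n" "v \<in> carrier_vec n" "w \<in> carrier_vec n"
  shows "conjugate v \<bullet> (mat_adjoint K *\<^sub>v w) = conjugate (K *\<^sub>v v) \<bullet> w"
proof -
  have "conjugate v \<bullet> (mat_adjoint K *\<^sub>v w) = (\<Sum>j<n. \<Sum>i<n. cnj (v $ j) * (cnj (K $$ (i, j)) * w $ i))"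
    using assms by (auto simp: scalar_prod_def atLeast0LessThan conjugate_complex_def sum_distrib_left intro!: sum.cong)
  also have "\<dots> = (\<Sum>i<n. \<Sum>j<n. cnj (K $$ (i, j)) * cnj (v $ j) * w $ i)"
    by (subst sum.swap) (simp add: mult_ac)
  also have "\<dots> = conjugate (K *\<^sub>v v) \<bullet> w"
    using assms by (auto simp: scalar_prod_def atLeast0LessThan conjugate_complex_def sum_distrib_right intro!: sum.cong)
  finally show ?thesis .
qed

lemma pos_def_carrier: "pos_def_mat n A \<Longrightarrow> A \<in> carrier_mat n n"
  by (simp add: pos_def_mat_def hermitian_mat_def)

lemma pos_def_adj: "pos_def_mat n A \<Longrightarrow> mat_adjoint A = A"
  by (simp add: pos_def_mat_def hermitian_mat_def)

text \<open>The quadratic form at v is that of A at K v, and the left inverse L keeps K v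
  nonzero.\<close>

lemma pos_def_congr:
  assumes A: "pos_def_mat n A" and K: "K \<in> carrier_mat n n" "L \<in> carrier_mat n n" "L * K = 1\<^sub>m n"
  shows "pos_def_mat n (mat_adjoint K * A * K)"
  unfolding pos_def_mat_def hermitian_mat_def
proof (intro conjI ballI impI)
  note Ac = pos_def_carrier[OF A]
  show "mat_adjoint K * A * K \<in> carrier_mat n n" using Ac K by auto
  show "mat_adjoint (mat_adjoint K * A * K) = mat_adjoint K * A * K"
    using Ac K pos_def_adj[OF A] by (simp add: adj_mult[of _ n n _ n] assoc3[of _ n] carrier_mult)
  fix v :: "complex vec" assume v: "v \<in> carrier_vec n" "v \<noteq> 0\<^sub>v n"
  have "K *\<^sub>v v \<noteq> 0\<^sub>v n"
  proof
    assume "K *\<^sub>v v = 0\<^sub>v n"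
    then have "L *\<^sub>v (K *\<^sub>v v) = 0\<^sub>v n" using K by (auto intro!: eq_vecI)
    then have "(L * K) *\<^sub>v v = 0\<^sub>v n" using assoc_mult_mat_vec[OF K(2,1) v(1)] by simp
    then show False using K v by simp
  qed
  moreover have "conjugate v \<bullet> ((mat_adjoint K * A * K) *\<^sub>v v) = conjugate (K *\<^sub>v v) \<bullet> (A *\<^sub>v (K *\<^sub>v v))"
  proof -
    have "(mat_adjoint K * A * K) *\<^sub>v v = mat_adjoint K *\<^sub>v (A *\<^sub>v (K *\<^sub>v v))"
      using Ac K v by (simp add: assoc3[of _ n] assoc_mult_mat_vec[of _ n n _ n])
    then show ?thesis using conjugate_mult_adj[OF K(1) v(1), of "A *\<^sub>v (K *\<^sub>v v)"] Ac K v by simp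
  qed
  ultimately show "0 < Re (conjugate v \<bullet> ((mat_adjoint K * A * K) *\<^sub>v v))"
    using A K v by (simp add: pos_def_mat_def)
qed

lemma pos_def_real_diag:
  assumes "\<And>i. i < n \<Longrightarrow> 0 < d i"
  shows "pos_def_mat n (real_diag n d)"
  unfolding pos_def_mat_def hermitian_mat_def
proof (intro conjI ballI impI)
  fix v :: "complex vec" assume v: "v \<in> carrier_vec n" "v \<noteq> 0\<^sub>v n"
  then obtain k where k: "k < n" "v $ k \<noteq> 0" by (metis carrier_vecD eq_vecI index_zero_vec)
  have dv: "(real_diag n d *\<^sub>v v) $ i = complex_of_real (d i) * v $ i" if "i < n" for i
  proof -
    have "(real_diag n d *\<^sub>v v) $ i = (\<Sum>j<n. real_diag n d $$ (i, j) * v $ j)"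
      using that v by (auto simp: scalar_prod_def atLeast0LessThan intro!: sum.cong)
    also have "\<dots> = (\<Sum>j<n. if i = j then complex_of_real (d i) * v $ i else 0)"
      using that by (intro sum.cong) auto
    finally show ?thesis using that by simp
  qed
  have "conjugate v \<bullet> (real_diag n d *\<^sub>v v) = (\<Sum>i<n. cnj (v $ i) * (complex_of_real (d i) * v $ i))"
    using v dv unfolding scalar_prod_def
    by (auto simp: atLeast0LessThan conjugate_complex_def simp del: index_mult_mat_vec intro!: sum.cong)
  also have "\<dots> = complex_of_real (\<Sum>i<n. d i * (cmod (v $ i))\<^sup>2)"
    unfolding of_real_sum of_real_mult complex_norm_square by (intro sum.cong) auto
  finally have "Re (conjugate v \<bullet> (real_diag n d *\<^sub>v v)) = (\<Sum>i<n. d i * (cmod (v $ i))\<^sup>2)" by simp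
  moreover have "0 < (\<Sum>i<n. d i * (cmod (v $ i))\<^sup>2)"
    by (rule sum_pos2[of _ k]) (use k assms in \<open>auto simp: less_imp_le\<close>)
  ultimately show "0 < Re (conjugate v \<bullet> (real_diag n d *\<^sub>v v))" by simp
qed auto

lemma eig_pos_def:
  assumes "eig n A U d"
  shows "pos_def_mat n A"
  using pos_def_congr[OF pos_def_real_diag[of n d], of "mat_adjoint U" U] eigD[OF assms] unitary_right by simp

text \<open>The eigenvalue d i is the quadratic form of A at column i of U, which is nonzero because
  U is unitary.\<close>

lemma pos_def_eig:
  assumes A: "pos_def_mat n A"
  shows "\<exists>U d. eig n A U d"
proof -
  have "hermitian_mat n A" using A by (simp add: pos_def_mat_def)
  then obtain U d where U: "unitary_mat n U" "A = U * real_diag n d * mat_adjoint U"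
    using hermitian_spectral by blast
  note Uc = unitary_carrier[OF U(1)]
  note Ac = pos_def_carrier[OF A]
  have "0 < d i" if i: "i < n" for i
  proof -
    have nz: "col U i \<noteq> 0\<^sub>v n"
    proof
      assume 0: "col U i = 0\<^sub>v n"
      have "1 = (mat_adjoint U * (1\<^sub>m n * U)) $$ (i, i)"
        using i Uc by (simp add: unitary_left[OF U(1)] del: index_mult_mat(1))
      also have "\<dots> = 0" using quadform_col[of "1\<^sub>m n" n U i] i Uc 0 by simp
      finally show False by simp
    qed
    have "mat_adjoint U * (A * U) = real_diag n d"
      unfolding U(2) using Uc
      by (simp add: assoc3[of _ n] carrier_mult cancel_left[of _ _ n] unitary_left[OF U(1)])
    then have "conjugate (col U i) \<bullet> (A *\<^sub>v col U i) = complex_of_real (d i)"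
      using quadform_col[OF Ac Uc i] i by simp
    then show ?thesis using A nz Uc i unfolding pos_def_mat_def
      by (metis Re_complex_of_real carrier_vecI carrier_matD(1) dim_col)
  qed
  then show ?thesis using U by (auto simp: eig_def)
qed

section \<open>Laws of powers and invariance under unitary conjugation\<close>

lemma eig_powr:
  assumes "eig n A U d"
  shows "eig n (mat_powr A r) U (\<lambda>i. d i powr r)"
    using eigD[OF assms] mat_powr_eig[OF assms] unfolding eig_def by (metis powr_gt_zero less_irrefl)

lemma pos_def_powr: "pos_def_mat n A \<Longrightarrow> pos_def_mat n (mat_powr A r)"
  using pos_def_eig eig_powr eig_pos_def by blast

lemma powr_carrier [simp]: "pos_def_mat n A \<Longrightarrow> mat_powr A r \<in> carrier_mat n n"
  by (simp add: pos_def_powr pos_def_carrier)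

lemma adj_powr [simp]: "pos_def_mat n A \<Longrightarrow> mat_adjoint (mat_powr A r) = mat_powr A r"
  by (meson pos_def_powr pos_def_adj)

lemma powr_mult_powr:
  assumes "pos_def_mat n A"
  shows "mat_powr A r * mat_powr A s = mat_powr A (r + s)"
proof -
  obtain U d where e: "eig n A U d" using pos_def_eig[OF assms] by blast
  note D = eigD[OF e]
  have "mat_powr A r * mat_powr A s = U * (real_diag n (\<lambda>i. d i powr r) * real_diag n (\<lambda>i. d i powr s)) * mat_adjoint U"
    unfolding mat_powr_eig[OF e] using D(4)
    by (simp add: assoc3[of _ n] carrier_mult cancel_left[of _ _ n] unitary_left[OF D(1)])
  then show ?thesis unfolding mat_powr_eig[OF e] real_diag_mult by (simp add: powr_add)
qed

lemma powr_powr_mat: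
  assumes "pos_def_mat n A"
  shows "mat_powr (mat_powr A r) s = mat_powr A (r * s)"
proof -
  obtain U d where e: "eig n A U d" using pos_def_eig[OF assms] by blast
  show ?thesis unfolding mat_powr_eig[OF e] mat_powr_eig[OF eig_powr[OF e], unfolded mat_powr_eig[OF e]]
    by (simp add: powr_powr)
qed

lemma powr_one_mat:
  assumes "pos_def_mat n A"
  shows "mat_powr A 1 = A"
proof -
  obtain U d where e: "eig n A U d" using pos_def_eig[OF assms] by blast
  have "real_diag n (\<lambda>i. d i powr 1) = real_diag n d" by (rule real_diag_cong) (use eigD(2)[OF e] in \<open>auto simp: less_imp_le\<close>)
  then show ?thesis unfolding mat_powr_eig[OF e] using eigD(3)[OF e] by simp
qed

lemma powr_zero_mat:
  assumes "pos_def_mat n A"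
  shows "mat_powr A 0 = 1\<^sub>m n"
proof -
  obtain U d where e: "eig n A U d" using pos_def_eig[OF assms] by blast
  have "real_diag n (\<lambda>i. d i powr 0) = real_diag n (\<lambda>i. 1)" by (rule real_diag_cong) (use eigD(2)[OF e] in force)
  then show ?thesis unfolding mat_powr_eig[OF e] real_diag_one using eigD[OF e] by (simp only: right_mult_one_mat unitary_right)
qed

lemma eig_unitary:
  assumes "eig n A U d" "unitary_mat n V"
  shows "eig n (V * A * mat_adjoint V) (V * U) d"
  using eigD[OF assms(1)] unitary_mult[OF assms(2) eigD(1)[OF assms(1)]] unitary_carrier[OF assms(2)]
  by (simp add: eig_def assoc3[of _ n] carrier_mult adj_mult[of _ n n _ n])

lemma powr_unitary:
  assumes "pos_def_mat n A" "unitary_mat n V"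
  shows "mat_powr (V * A * mat_adjoint V) r = V * mat_powr A r * mat_adjoint V"
proof -
  obtain U d where e: "eig n A U d" using pos_def_eig[OF assms(1)] by blast
  show ?thesis
    unfolding mat_powr_eig[OF e] mat_powr_eig[OF eig_unitary[OF e assms(2)]]
    using eigD(4)[OF e] unitary_carrier[OF assms(2)]
    by (simp add: assoc3[of _ n] carrier_mult adj_mult[of _ n n _ n])
qed

lemma re_trace_unitary:
  assumes "A \<in> carrier_mat n n" "unitary_mat n V"
  shows "re_trace (V * A * mat_adjoint V) = re_trace A"
proof -
  note Vc = unitary_carrier[OF assms(2)]
  have "re_trace (V * A * mat_adjoint V) = re_trace (mat_adjoint V * (V * A))"
    by (rule re_trace_comm[of _ n n]) (use assms Vc in auto)
  then show ?thesis using assms Vc by (simp add: cancel_left[of _ _ n] unitary_left)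
qed

lemma re_trace_eig:
  assumes "eig n A U d"
  shows "re_trace A = (\<Sum>i<n. d i)"
  using eigD[OF assms] re_trace_unitary[of "real_diag n d" n U] by (simp add: re_trace_real_diag)

text \<open>By the polar decomposition, \<open>X X\<^sup>*\<close> and \<open>X\<^sup>* X\<close> are unitarily equivalent.\<close>
lemma re_trace_powr_swap:
  fixes X :: "complex mat"
  assumes X: "X \<in> carrier_mat n n" "Y \<in> carrier_mat n n" "Y * X = 1\<^sub>m n"
  shows "re_trace (mat_powr (X * mat_adjoint X) s) = re_trace (mat_powr (mat_adjoint X * X) s)"
proof -
  have "pos_def_mat n (mat_adjoint X * X)"
    using pos_def_congr[OF pos_def_real_diag[of n "\<lambda>_. 1"] X] X by (simp add: real_diag_one)
  then obtain U d where e: "eig n (mat_adjoint X * X) U d" using pos_def_eig by blast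
  note D = eigD[OF e]
  define R where "R r = real_diag n (\<lambda>i. d i powr r)" for r
  have R: "R r \<in> carrier_mat n n" "mat_adjoint (R r) = R r" for r by (auto simp: R_def)
  have RR: "R r * R r' = R (r + r')" for r r' by (simp add: R_def real_diag_mult powr_add)
  have R1: "R 1 = real_diag n d" unfolding R_def by (rule real_diag_cong) (use D(2) in \<open>auto simp: less_imp_le\<close>)
  have R0: "R 0 = 1\<^sub>m n" unfolding R_def real_diag_one[symmetric] by (rule real_diag_cong) (use D(2) in force)
  \<comment> \<open>The unitary polar factor of X, multiplied by U. Its columns are the eigenvectors
    of X X^* that belong to the same eigenvalues d.\<close>
  define V where "V = X * U * R (-(1/2))"
  note c = X(1) D(4) R
  note s = assoc3[of _ n] carrier_mult cancel_left[of _ _ n] adj_mult[of _ n n _ n]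
     unitary_left[OF D(1)] unitary_right[OF D(1)]
  have Vc: "V \<in> carrier_mat n n" unfolding V_def using c by (simp add: carrier_mult)
  have "mat_adjoint V * V = R (-(1/2)) * (mat_adjoint U * (mat_adjoint X * X) * U) * R (-(1/2))"
    unfolding V_def using c by (simp add: s)
  also have "mat_adjoint U * (mat_adjoint X * X) * U = R 1"
    unfolding D(3) R1 using c by (simp add: s)
  also have "R (-(1/2)) * R 1 * R (-(1/2)) = 1\<^sub>m n" by (simp add: RR R0)
  finally have V: "unitary_mat n V" using Vc by (intro unitaryI)
  have "R (-(1/2)) * (R 1 * R (-(1/2))) = 1\<^sub>m n" by (simp add: RR R0)
  then have c1: "R (-(1/2)) * (R 1 * (R (-(1/2)) * Z)) = Z" if "Z \<in> carrier_mat n n" for Z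
    using that c by (simp add: assoc3[of _ n, symmetric] carrier_mult)
  have "V * real_diag n d * mat_adjoint V = X * mat_adjoint X"
    unfolding V_def R1[symmetric] using c by (simp add: s c1)
  then have e2: "eig n (X * mat_adjoint X) V d" using V D(2) by (simp add: eig_def)
  show ?thesis using re_trace_eig[OF eig_powr[OF e]] re_trace_eig[OF eig_powr[OF e2]] by simp
qed

text \<open>A trace in two matrices becomes a sum over pairs of eigenvalues with nonnegative
  weights, the squared moduli of K between the two eigenbases. Scalar inequalities and integrals can
  then be summed termwise.\<close>

lemma re_trace_two_spectral:
  assumes U: "unitary_mat n U" and V: "unitary_mat n V" and K: "K \<in> carrier_mat n n"
  shows "re_trace (mat_adjoint K * (U * real_diag n f * mat_adjoint U) * K * (V * real_diag n g * mat_adjoint V))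
    = (\<Sum>i<n. \<Sum>j<n. f i * g j * (cmod ((mat_adjoint U * K * V) $$ (i, j)))\<^sup>2)"
proof -
  note c = unitary_carrier[OF U] unitary_carrier[OF V] K
  define k where "k = mat_adjoint U * K * V"
  have k: "k \<in> carrier_mat n n" using c by (auto simp: k_def)
  have "re_trace (mat_adjoint K * (U * real_diag n f * mat_adjoint U) * K * (V * real_diag n g * mat_adjoint V))
    = re_trace ((mat_adjoint K * (U * real_diag n f * mat_adjoint U) * K * V * real_diag n g) * mat_adjoint V)"
    using c by (simp add: assoc3[of _ n] carrier_mult)
  also have "\<dots> = re_trace (mat_adjoint V * (mat_adjoint K * (U * real_diag n f * mat_adjoint U) * K * V * real_diag n g))"
    by (rule re_trace_comm[of _ n n]) (use c in auto)
  also have "\<dots> = re_trace (mat_adjoint k * (real_diag n f * k * real_diag n g))"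
    unfolding k_def using c by (simp add: assoc3[of _ n] carrier_mult adj_mult[of _ n n _ n])
  also have "\<dots> = (\<Sum>j<n. Re (\<Sum>i<n. mat_adjoint k $$ (j, i) * (real_diag n f * k * real_diag n g) $$ (i, j)))"
    using k by (subst re_trace_sum[of _ n], simp add: carrier_mult)
      (intro sum.cong refl arg_cong[of _ _ Re] mult_index, auto simp: carrier_mult)
  also have "\<dots> = (\<Sum>j<n. Re (\<Sum>i<n. complex_of_real (f i * g j * (cmod (k $$ (i, j)))\<^sup>2)))"
  proof (intro sum.cong refl arg_cong[of _ _ Re])
    fix i j assume ij: "i \<in> {..<n}" "j \<in> {..<n}"
    have "(real_diag n f * k * real_diag n g) $$ (i, j) = complex_of_real (f i) * k $$ (i, j) * complex_of_real (g j)"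
      using ij k by (simp add: mult_real_diag_index[of _ n n] real_diag_mult_index[of _ n n] carrier_mult del: index_mult_mat(1))
    moreover have "mat_adjoint k $$ (j, i) = cnj (k $$ (i, j))" using ij k by simp
    ultimately show "mat_adjoint k $$ (j, i) * (real_diag n f * k * real_diag n g) $$ (i, j)
      = complex_of_real (f i * g j * (cmod (k $$ (i, j)))\<^sup>2)"
      unfolding of_real_mult complex_norm_square by (simp add: mult_ac)
  qed
  also have "\<dots> = (\<Sum>i<n. \<Sum>j<n. f i * g j * (cmod (k $$ (i, j)))\<^sup>2)"
    by (subst sum.swap) simp
  finally show ?thesis unfolding k_def .
qed

section \<open>Convex combinations of matrices\<close>

definition mix :: "real \<Rightarrow> complex mat \<Rightarrow> complex mat \<Rightarrow> complex mat" where
  "mix t A B = complex_of_real t \<cdot>\<^sub>m A + complex_of_real (1 - t) \<cdot>\<^sub>m B"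

lemma mix_carrier [simp]:
  "A \<in> carrier_mat n n \<Longrightarrow> B \<in> carrier_mat n n \<Longrightarrow> mix t A B \<in> carrier_mat n n"
  by (simp add: mix_def)

lemma mult_mix:
  assumes "A \<in> carrier_mat n n" "B \<in> carrier_mat n n" "X \<in> carrier_mat n n"
  shows "X * mix t A B = mix t (X * A) (X * B)" "mix t A B * X = mix t (A * X) (B * X)"
  unfolding mix_def using assms
  by (simp_all add: mult_add_distrib_mat[of _ n n _ n] add_mult_distrib_mat[of _ n n _ _ n]
      mult_smult_distrib[of _ n n _ n] mult_smult_assoc_mat[of _ n n _ n])

lemma re_trace_mix:
  assumes "A \<in> carrier_mat n n" "B \<in> carrier_mat n n"
  shows "re_trace (mix t A B) = t * re_trace A + (1 - t) * re_trace B"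
  unfolding mix_def using assms by (simp only: re_trace_add[of _ n] re_trace_smult[of _ n] smult_carrier_mat)

lemma smult_mat_mult_vec:
  fixes A :: "complex mat"
  assumes "A \<in> carrier_mat n n" "v \<in> carrier_vec n"
  shows "(c \<cdot>\<^sub>m A) *\<^sub>v v = c \<cdot>\<^sub>v (A *\<^sub>v v)"
  using assms by (intro eq_vecI) (auto simp: scalar_prod_def sum_distrib_left mult.assoc)

lemma pos_def_mix:
  assumes "pos_def_mat n A" "pos_def_mat n B" "0 \<le> t" "t \<le> 1"
  shows "pos_def_mat n (mix t A B)"
  unfolding pos_def_mat_def hermitian_mat_def
proof (intro conjI ballI impI)
  note c = pos_def_carrier[OF assms(1)] pos_def_carrier[OF assms(2)]
  show "mix t A B \<in> carrier_mat n n" using c by simp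
  show "mat_adjoint (mix t A B) = mix t A B"
    unfolding mix_def using c pos_def_adj[OF assms(1)] pos_def_adj[OF assms(2)]
    by (subst adj_add[of _ n n]) (auto simp: adj_smult)
  fix v :: "complex vec" assume v: "v \<in> carrier_vec n" "v \<noteq> 0\<^sub>v n"
  have "conjugate v \<bullet> (mix t A B *\<^sub>v v) = complex_of_real t * (conjugate v \<bullet> (A *\<^sub>v v))
     + complex_of_real (1 - t) * (conjugate v \<bullet> (B *\<^sub>v v))"
  proof -
    have "mix t A B *\<^sub>v v = complex_of_real t \<cdot>\<^sub>v (A *\<^sub>v v) + complex_of_real (1 - t) \<cdot>\<^sub>v (B *\<^sub>v v)"
      unfolding mix_def using c v
      by (subst add_mult_distrib_mat_vec[of _ n n]) (auto simp: smult_mat_mult_vec)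
    then show ?thesis using c v
      by (subst (1) \<open>mix t A B *\<^sub>v v = _\<close>) (subst scalar_prod_add_distrib[of _ n], auto)
  qed
  then have "Re (conjugate v \<bullet> (mix t A B *\<^sub>v v)) = t * Re (conjugate v \<bullet> (A *\<^sub>v v))
     + (1 - t) * Re (conjugate v \<bullet> (B *\<^sub>v v))" by simp
  moreover have "0 < Re (conjugate v \<bullet> (A *\<^sub>v v))" "0 < Re (conjugate v \<bullet> (B *\<^sub>v v))"
    using assms(1,2) v by (auto simp: pos_def_mat_def)
  ultimately show "0 < Re (conjugate v \<bullet> (mix t A B *\<^sub>v v))"
    using assms(3,4) by (cases "t = 0") (auto intro: add_pos_nonneg)
qed

section \<open>Lieb's concavity theorem\<close>

text \<open>Substituting l = (b/a) m separates a and b and leaves the integral of m^(u-1) / (1 + m)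
  over the positive half-line. Its value pi / sin (pi u) is immaterial; what counts is that it is
  finite and, so that it can be cancelled from Lieb's inequality, positive.\<close>

lemma Lieb_kernel_integral:
  fixes u :: real
  assumes u: "0 < u" "u < 1"
  obtains C where "0 < C" "\<And>a b. 0 < a \<Longrightarrow> 0 < b \<Longrightarrow>
    has_bochner_integral lborel (\<lambda>l. indicator {0<..} l * (l powr (u - 1) * (a * b / (b + l * a))))
      (C * (a powr (1 - u) * b powr u))"
proof -
  define \<phi> where "\<phi> l = indicator {0<..} l * (l powr (u - 1) / (1 + l))" for l :: real
  have \<phi>0: "0 \<le> \<phi> l" for l by (auto simp: \<phi>_def indicator_def)
  have [measurable]: "\<phi> \<in> borel_measurable borel" unfolding \<phi>_def by measurable
  define I where "I = (\<integral>\<^sup>+ l. ennreal (\<phi> l) \<partial>lborel)"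
  \<comment> \<open>The majorant is split at 1: u - 1 > -1 gives integrability at 0, and beyond 1
    the kernel is at most l^(u-2), where u - 2 < -1.\<close>
  have i1: "(\<integral>\<^sup>+ l. ennreal (indicator {0..1} l * l powr (u - 1)) \<partial>lborel) < \<infinity>"
  proof -
    have "((\<lambda>l. l powr (u - 1)) has_integral (1 powr (u - 1 + 1) / (u - 1 + 1))) {0..1::real}"
      using has_integral_powr_from_0[of "u - 1" 1] u by simp
    then show ?thesis by (subst nn_integral_has_integral_lebesgue) auto
  qed
  have i2: "(\<integral>\<^sup>+ l. ennreal (indicator {1..} l * l powr (u - 2)) \<partial>lborel) < \<infinity>"
  proof -
    have "((\<lambda>l. l powr (u - 2)) has_integral (- (1 powr (u - 2 + 1)) / (u - 2 + 1))) {1::real..}"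
      using has_integral_powr_to_inf[of "u - 2" 1] u by simp
    then show ?thesis by (subst nn_integral_has_integral_lebesgue) auto
  qed
  have "I \<le> (\<integral>\<^sup>+ l. ennreal (indicator {0..1} l * l powr (u - 1)) + ennreal (indicator {1..} l * l powr (u - 2)) \<partial>lborel)"
    unfolding I_def
  proof (rule nn_integral_mono)
    fix l :: real
    have "\<phi> l \<le> indicator {0..1} l * l powr (u - 1) + indicator {1..} l * l powr (u - 2)"
    proof (cases "l \<le> 0 \<or> l \<le> 1")
      case True
      then show ?thesis
        by (auto simp: \<phi>_def indicator_def divide_le_eq mult_le_cancel_left1)
    next
      case False
      then have l: "l > 1" by auto
      have "l powr (u - 1) = l powr (u - 2) * l"
        using l powr_add[of l "u - 2" 1] by simp
      also have "\<dots> \<le> l powr (u - 2) * (1 + l)" using l by (intro mult_left_mono) auto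
      finally show ?thesis using l by (auto simp: \<phi>_def indicator_def divide_le_eq)
    qed
    then show "ennreal (\<phi> l) \<le> ennreal (indicator {0..1} l * l powr (u - 1)) + ennreal (indicator {1..} l * l powr (u - 2))"
      by (subst ennreal_plus[symmetric]) (auto simp del: ennreal_plus intro: ennreal_leI)
  qed
  also have "\<dots> = (\<integral>\<^sup>+ l. ennreal (indicator {0..1} l * l powr (u - 1)) \<partial>lborel) + (\<integral>\<^sup>+ l. ennreal (indicator {1..} l * l powr (u - 2)) \<partial>lborel)"
    by (rule nn_integral_add) auto
  also have "\<dots> < \<infinity>" using i1 i2 by simp
  finally have Ifin: "I < \<infinity>" .
  define C where "C = enn2real I"
  have IC: "I = ennreal C" using Ifin by (simp add: C_def)
  \<comment> \<open>Positivity of C: on [1, 2] one has l^(u-1) >= 1/l >= 1/2 and 1 + l <= 3, so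
    \<open>\<phi>\<close> is at least 1/6 there.\<close>
  have "ennreal (1/6) = (\<integral>\<^sup>+ l. ennreal (1/6) * indicator {1..2::real} l \<partial>lborel)"
    by (subst nn_integral_cmult_indicator) auto
  also have "\<dots> \<le> I"
    unfolding I_def
  proof (rule nn_integral_mono)
    fix l :: real
    show "ennreal (1/6) * indicator {1..2} l \<le> ennreal (\<phi> l)"
    proof (cases "l \<in> {1..2}")
      case True
      have "l powr (-1) \<le> l powr (u - 1)" using True u by (intro powr_mono) auto
      moreover have "l powr (-1) \<ge> 1/2" using True by (simp add: powr_minus field_simps)
      ultimately have "1/2 \<le> l powr (u - 1)" by linarith
      then have "1/6 * (1 + l) \<le> l powr (u - 1)" using True by simp
      then have "1/6 \<le> \<phi> l" using True by (simp add: \<phi>_def le_divide_eq)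
      then show ?thesis using True by (auto intro: ennreal_leI)
    qed auto
  qed
  finally have C0: "0 < C" unfolding IC by (simp add: ennreal_le_iff2)
  have "has_bochner_integral lborel (\<lambda>l. indicator {0<..} l * (l powr (u - 1) * (a * b / (b + l * a))))
      (C * (a powr (1 - u) * b powr u))" if ab: "0 < a" "0 < b" for a b :: real
  proof (rule has_bochner_integral_nn_integral)
    let ?h = "\<lambda>l::real. indicator {0<..} l * (l powr (u - 1) * (a * b / (b + l * a)))"
    show [measurable]: "?h \<in> borel_measurable lborel" by measurable
    show "AE l in lborel. 0 \<le> ?h l" using ab by (auto simp: indicator_def)
    show "0 \<le> C * (a powr (1 - u) * b powr u)" using C0 by auto
    \<comment> \<open>The shape \<open>0 + b / a * m\<close> is the affine substitution of
      \<open>nn_integral_real_affine\<close>. For m <= 0 both sides vanish.\<close>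
    have h: "?h (0 + b / a * m) = a * (b / a) powr (u - 1) * \<phi> m" for m
    proof (cases "m > 0")
      case True
      then have "b + m * b \<noteq> 0" using ab by (smt (verit) mult_pos_pos)
      then have "a * b / (b + b / a * m * a) = a / (1 + m)" using ab True by (simp add: field_simps)
      moreover have "(b / a * m) powr (u - 1) = (b / a) powr (u - 1) * m powr (u - 1)"
        by (rule powr_mult)
      ultimately show ?thesis using ab True by (simp add: \<phi>_def)
    next
      case False
      then have "\<not> 0 < b / a * m" using ab by (simp add: zero_less_mult_iff zero_less_divide_iff)
      then show ?thesis using False by (simp add: \<phi>_def)
    qed
    have "(\<integral>\<^sup>+ l. ennreal (?h l) \<partial>lborel) = ennreal \<bar>b / a\<bar> * (\<integral>\<^sup>+ m. ennreal (?h (0 + b / a * m)) \<partial>lborel)"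
      by (rule nn_integral_real_affine) (use ab in auto)
    also have "\<dots> = ennreal (b / a) * (\<integral>\<^sup>+ m. ennreal (a * (b / a) powr (u - 1)) * ennreal (\<phi> m) \<partial>lborel)"
      unfolding h using ab \<phi>0 by (simp add: ennreal_mult)
    also have "\<dots> = ennreal (b / a) * (ennreal (a * (b / a) powr (u - 1)) * ennreal C)"
      by (subst nn_integral_cmult) (auto simp: I_def[symmetric] IC)
    also have "\<dots> = ennreal (b / a * (a * (b / a) powr (u - 1)) * C)"
    proof -
      have "ennreal x * (ennreal y * ennreal z) = ennreal (x * y * z)" if "0 \<le> x" "0 \<le> y" "0 \<le> z" for x y z
        using that by (simp add: ennreal_mult mult.assoc)
      then show ?thesis using ab C0 by simp
    qed
    also have "b / a * (a * (b / a) powr (u - 1)) = a powr (1 - u) * b powr u"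
    proof -
      have "b / a * (a * (b / a) powr (u - 1)) = a * ((b / a) powr 1 * (b / a) powr (u - 1))" using ab by simp
      also have "\<dots> = a powr 1 * (b / a) powr u" using ab by (simp only: powr_add[symmetric]) simp
      also have "\<dots> = a powr 1 * (b powr u / a powr u)" using ab by (simp add: powr_divide)
      also have "\<dots> = a powr (1 - u) * b powr u" by (simp add: powr_diff)
      finally show ?thesis .
    qed
    finally show "(\<integral>\<^sup>+ l. ennreal (?h l) \<partial>lborel) = ennreal (C * (a powr (1 - u) * b powr u))"
      by (simp add: mult.commute)
  qed
  then show ?thesis using that C0 by blast
qed

lemma re_trace_two_eig:
  assumes A: "eig n A U a" and B: "eig n B V b" and K: "K \<in> carrier_mat n n"
  shows "re_trace (mat_adjoint K * mat_powr A r * K * mat_powr B s)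
    = (\<Sum>i<n. \<Sum>j<n. a i powr r * b j powr s * (cmod ((mat_adjoint U * K * V) $$ (i, j)))\<^sup>2)"
  unfolding mat_powr_eig[OF A] mat_powr_eig[OF B]
  by (rule re_trace_two_spectral[OF eigD(1)[OF A] eigD(1)[OF B] K])

text \<open>The coefficient on the left is the parallel sum of a and b / l. After the triangle
  inequality and clearing of denominators, the gap is the square of l a |x| - b |k - x|.\<close>

lemma parallel_sum_le:
  fixes x k :: complex
  assumes "0 < a" "0 < b" "0 < l"
  shows "a * b / (b + l * a) * (cmod k)\<^sup>2 \<le> a * (cmod x)\<^sup>2 + b / l * (cmod (k - x))\<^sup>2"
proof -
  have p: "0 < b + l * a" using assms by (simp add: add_pos_pos)
  have "(cmod k)\<^sup>2 \<le> (cmod x + cmod (k - x))\<^sup>2"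
    by (rule power_mono) (use norm_triangle_ineq[of x "k - x"] in auto)
  then have "a * b * l * (cmod k)\<^sup>2 \<le> a * b * l * (cmod x + cmod (k - x))\<^sup>2"
    using assms by simp
  also have "\<dots> \<le> (l * a * (cmod x)\<^sup>2 + b * (cmod (k - x))\<^sup>2) * (b + l * a)"
    using zero_le_power2[of "l * a * cmod x - b * cmod (k - x)"]
    by (simp add: power2_eq_square algebra_simps)
  finally have "a * b * l * (cmod k)\<^sup>2 \<le> (l * a * (cmod x)\<^sup>2 + b * (cmod (k - x))\<^sup>2) * (b + l * a)" .
  then have "a * b * (cmod k)\<^sup>2 \<le> (a * (cmod x)\<^sup>2 + b / l * (cmod (k - x))\<^sup>2) * (b + l * a)"
    using assms by (simp add: field_simps)
  then show ?thesis using p by (simp add: pos_divide_le_eq)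
qed

text \<open>The quadratic form of the parallel sum of left multiplication by \<open>A\<close> and right
  multiplication by \<open>B / l\<close>, as an infimum of functions that are linear in \<open>(A, B)\<close>.\<close>
lemma
  assumes A: "eig n A U a" and B: "eig n B V b" and K: "K \<in> carrier_mat n n" and l: "0 < l"
  defines "G \<equiv> \<Sum>i<n. \<Sum>j<n. a i * b j / (b j + l * a i) * (cmod ((mat_adjoint U * K * V) $$ (i, j)))\<^sup>2"
  shows parallel_sum_lower: "X \<in> carrier_mat n n \<Longrightarrow>
      G \<le> re_trace (mat_adjoint X * A * X) + 1 / l * re_trace (mat_adjoint (K - X) * (K - X) * B)"
    and parallel_sum_attained: "\<exists>X \<in> carrier_mat n n.
      G = re_trace (mat_adjoint X * A * X) + 1 / l * re_trace (mat_adjoint (K - X) * (K - X) * B)"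
proof -
  note DA = eigD[OF A] and DB = eigD[OF B]
  define k where "k = mat_adjoint U * K * V"
  have k: "k \<in> carrier_mat n n" unfolding k_def using DA DB K by auto
  \<comment> \<open>The identity is written in spectral form in the other eigenbasis, so that a
    trace containing only one of A and B also fits \<open>re_trace_two_spectral\<close>.\<close>
  have one: "V * real_diag n (\<lambda>_. 1) * mat_adjoint V = 1\<^sub>m n" "U * real_diag n (\<lambda>_. 1) * mat_adjoint U = 1\<^sub>m n"
    using DA DB by (simp_all add: real_diag_one unitary_right)
  \<comment> \<open>In the two eigenbases the minimisation over X decouples into one scalar problem
    per entry.\<close>
  have eq: "re_trace (mat_adjoint X * A * X) + 1 / l * re_trace (mat_adjoint (K - X) * (K - X) * B)
     = (\<Sum>i<n. \<Sum>j<n. a i * (cmod ((mat_adjoint U * X * V) $$ (i, j)))\<^sup>2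
         + b j / l * (cmod (k $$ (i, j) - (mat_adjoint U * X * V) $$ (i, j)))\<^sup>2)"
    if X: "X \<in> carrier_mat n n" for X
  proof -
    have "mat_adjoint U * (K - X) * V = k - mat_adjoint U * X * V"
      unfolding k_def using X K DA DB
      by (simp add: mult_minus_distrib_mat[of _ n n _ n] minus_mult_distrib_mat[of _ n n _ _ n] carrier_mult)
    then have kx: "(mat_adjoint U * (K - X) * V) $$ (i, j) = k $$ (i, j) - (mat_adjoint U * X * V) $$ (i, j)"
      if "i < n" "j < n" for i j
      using that k X DA DB by (simp add: carrier_mult del: index_mult_mat(1))
    have "re_trace (mat_adjoint X * A * X) = (\<Sum>i<n. \<Sum>j<n. a i * (cmod ((mat_adjoint U * X * V) $$ (i, j)))\<^sup>2)"
      using re_trace_two_spectral[OF DA(1) DB(1) X, of a "\<lambda>_. 1", unfolded one] DA(3,5) X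
      by (simp add: carrier_mult)
    moreover have "re_trace (mat_adjoint (K - X) * (K - X) * B)
      = (\<Sum>i<n. \<Sum>j<n. b j * (cmod (k $$ (i, j) - (mat_adjoint U * X * V) $$ (i, j)))\<^sup>2)"
      using re_trace_two_spectral[OF DA(1) DB(1), of "K - X" "\<lambda>_. 1" b, unfolded one] DB(3,5) X K kx
      by (simp add: minus_carrier_mat)
    ultimately show ?thesis
      by (simp add: sum.distrib sum_distrib_left)
  qed
  show "G \<le> re_trace (mat_adjoint X * A * X) + 1 / l * re_trace (mat_adjoint (K - X) * (K - X) * B)"
    if X: "X \<in> carrier_mat n n"
    unfolding eq[OF X] G_def k_def[symmetric]
    by (intro sum_mono parallel_sum_le) (use DA(2) DB(2) l in auto)
  \<comment> \<open>Entrywise the stationary point of a |x|^2 + (b / l) |k - x|^2, from a x = (b /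
    l) (k - x).\<close>
  define x where "x = mat n n (\<lambda>(i, j). k $$ (i, j) * complex_of_real (b j / (b j + l * a i)))"
  define X where "X = U * x * mat_adjoint V"
  have X: "X \<in> carrier_mat n n" unfolding X_def x_def using DA DB by (simp add: carrier_mult)
  have Xx: "mat_adjoint U * X * V = x"
    unfolding X_def using DA(4) DB(4)
    by (simp add: assoc3[of _ n] carrier_mult cancel_left[of _ _ n] unitary_left[OF DA(1)] unitary_left[OF DB(1)] x_def)
  have "G = re_trace (mat_adjoint X * A * X) + 1 / l * re_trace (mat_adjoint (K - X) * (K - X) * B)"
    unfolding eq[OF X] Xx G_def k_def[symmetric]
  proof (intro sum.cong refl)
    fix i j assume ij: "i \<in> {..<n}" "j \<in> {..<n}"
    define c where "c = b j + l * a i"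
    have ab: "0 < a i" "0 < b j" using DA(2) DB(2) ij by auto
    have c: "0 < c" unfolding c_def using ab l by (simp add: add_pos_pos)
    have x1: "cmod (x $$ (i, j)) = cmod (k $$ (i, j)) * (b j / c)"
    proof -
      have "x $$ (i, j) = k $$ (i, j) * complex_of_real (b j / c)" using ij by (simp add: x_def c_def)
      then show ?thesis using ab c by (simp only: norm_mult norm_of_real) simp
    qed
    have "k $$ (i, j) - x $$ (i, j) = k $$ (i, j) * complex_of_real (l * a i / c)"
    proof -
      have "1 - b j / c = l * a i / c" using c by (simp add: c_def field_simps)
      then have "complex_of_real (l * a i / c) = 1 - complex_of_real (b j / c)" by (metis of_real_1 of_real_diff)
      then show ?thesis using ij by (simp only:) (simp add: x_def c_def algebra_simps)
    qed
    then have x2: "cmod (k $$ (i, j) - x $$ (i, j)) = cmod (k $$ (i, j)) * (l * a i / c)"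
      using ab l c by (simp add: norm_mult norm_divide)
    have "a i * (b j / c)\<^sup>2 + b j / l * (l * a i / c)\<^sup>2 = a i * b j * (b j + l * a i) / c\<^sup>2"
      using l by (simp add: power_divide power2_eq_square algebra_simps add_divide_distrib)
    also have "\<dots> = a i * b j / c" unfolding c_def[symmetric] using c by (simp add: power2_eq_square)
    finally have e: "a i * (b j / c)\<^sup>2 + b j / l * (l * a i / c)\<^sup>2 = a i * b j / c" .
    show "a i * b j / (b j + l * a i) * (cmod (k $$ (i, j)))\<^sup>2
      = a i * (cmod (x $$ (i, j)))\<^sup>2 + b j / l * (cmod (k $$ (i, j) - x $$ (i, j)))\<^sup>2"
      unfolding x1 x2 c_def[symmetric] e[symmetric] power_mult_distrib by (simp only: distrib_left distrib_right mult_ac)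
  qed
  then show "\<exists>X \<in> carrier_mat n n.
      G = re_trace (mat_adjoint X * A * X) + 1 / l * re_trace (mat_adjoint (K - X) * (K - X) * B)"
    using X by blast
qed

text \<open>The sums \<open>G\<close> are the kernel of \<open>Lieb_kernel_integral\<close> summed
  over pairs of eigenvalues, and concavity holds for each l separately. The eigenbases of the
  endpoints and of the mixture are unrelated; they are compared through traces that do not mention
  them.\<close>

theorem Lieb_concavity:
  assumes A: "pos_def_mat n A1" "pos_def_mat n A2" and B: "pos_def_mat n B1" "pos_def_mat n B2"
    and K: "K \<in> carrier_mat n n" and t: "0 \<le> t" "t \<le> 1" and u: "0 < u" "u < 1"
  shows "t * re_trace (mat_adjoint K * mat_powr A1 (1 - u) * K * mat_powr B1 u)
      + (1 - t) * re_trace (mat_adjoint K * mat_powr A2 (1 - u) * K * mat_powr B2 u)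
    \<le> re_trace (mat_adjoint K * mat_powr (mix t A1 A2) (1 - u) * K * mat_powr (mix t B1 B2) u)"
proof -
  obtain C where C: "0 < C" "\<And>a b. 0 < a \<Longrightarrow> 0 < b \<Longrightarrow>
    has_bochner_integral lborel (\<lambda>l. indicator {0<..} l * (l powr (u - 1) * (a * b / (b + l * a))))
      (C * (a powr (1 - u) * b powr u))"
    using Lieb_kernel_integral[OF u] by blast
  define G where "G U a V b l = (\<Sum>i<n. \<Sum>j<n. a i * b j / (b j + l * a i) * (cmod ((mat_adjoint U * K * V) $$ (i, j)))\<^sup>2)"
    for U V a b and l :: real
  have int: "has_bochner_integral lborel (\<lambda>l. indicator {0<..} l * (l powr (u - 1) * G U a V b l))
      (C * re_trace (mat_adjoint K * mat_powr A (1 - u) * K * mat_powr B u))"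
    if e: "eig n A U a" "eig n B V b" for A B U V a b
  proof -
    have "has_bochner_integral lborel (\<lambda>l. \<Sum>i<n. \<Sum>j<n. (cmod ((mat_adjoint U * K * V) $$ (i, j)))\<^sup>2 *
        (indicator {0<..} l * (l powr (u - 1) * (a i * b j / (b j + l * a i)))))
      (\<Sum>i<n. \<Sum>j<n. (cmod ((mat_adjoint U * K * V) $$ (i, j)))\<^sup>2 * (C * (a i powr (1 - u) * b j powr u)))"
      by (intro has_bochner_integral_sum has_bochner_integral_mult_right C(2))
        (use eigD(2)[OF e(1)] eigD(2)[OF e(2)] in auto)
    moreover have "(\<Sum>i<n. \<Sum>j<n. (cmod ((mat_adjoint U * K * V) $$ (i, j)))\<^sup>2 * (C * (a i powr (1 - u) * b j powr u)))
      = C * re_trace (mat_adjoint K * mat_powr A (1 - u) * K * mat_powr B u)"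
      unfolding re_trace_two_eig[OF e K] sum_distrib_left by (simp add: mult_ac)
    moreover have "(\<lambda>l. \<Sum>i<n. \<Sum>j<n. (cmod ((mat_adjoint U * K * V) $$ (i, j)))\<^sup>2 *
        (indicator {0<..} l * (l powr (u - 1) * (a i * b j / (b j + l * a i)))))
      = (\<lambda>l. indicator {0<..} l * (l powr (u - 1) * G U a V b l))"
      unfolding G_def sum_distrib_left by (rule ext, intro sum.cong) (auto simp: mult_ac)
    ultimately show ?thesis by simp
  qed
  let ?A = "mix t A1 A2" and ?B = "mix t B1 B2"
  obtain U1 a1 where e1: "eig n A1 U1 a1" using pos_def_eig[OF A(1)] by blast
  obtain U2 a2 where e2: "eig n A2 U2 a2" using pos_def_eig[OF A(2)] by blast
  obtain U a where e: "eig n ?A U a" using pos_def_eig[OF pos_def_mix[OF A t]] by blast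
  obtain V1 b1 where f1: "eig n B1 V1 b1" using pos_def_eig[OF B(1)] by blast
  obtain V2 b2 where f2: "eig n B2 V2 b2" using pos_def_eig[OF B(2)] by blast
  obtain V b where f: "eig n ?B V b" using pos_def_eig[OF pos_def_mix[OF B t]] by blast
  note Ac = pos_def_carrier[OF A(1)] pos_def_carrier[OF A(2)]
    and Bc = pos_def_carrier[OF B(1)] pos_def_carrier[OF B(2)]
  have G: "t * G U1 a1 V1 b1 l + (1 - t) * G U2 a2 V2 b2 l \<le> G U a V b l" if l: "0 < l" for l
  proof -
    \<comment> \<open>X is optimal for the mixture and admissible at both endpoints, and for fixed X
      the functional is linear in the pair of matrices.\<close>
    obtain X where X: "X \<in> carrier_mat n n"
      "G U a V b l = re_trace (mat_adjoint X * ?A * X) + 1 / l * re_trace (mat_adjoint (K - X) * (K - X) * ?B)"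
      using parallel_sum_attained[OF e f K l] unfolding G_def by blast
    define Y where "Y = K - X"
    have Y: "Y \<in> carrier_mat n n" using X K by (simp add: Y_def minus_carrier_mat)
    have 1: "re_trace (mat_adjoint X * ?A * X) = t * re_trace (mat_adjoint X * A1 * X) + (1 - t) * re_trace (mat_adjoint X * A2 * X)"
      using X Ac by (simp add: mult_mix[of _ n] re_trace_mix[of _ n] carrier_mult)
    have 2: "re_trace (mat_adjoint Y * Y * ?B) = t * re_trace (mat_adjoint Y * Y * B1) + (1 - t) * re_trace (mat_adjoint Y * Y * B2)"
      using Y Bc by (simp add: mult_mix[of _ n] re_trace_mix[of _ n] carrier_mult)
    have "t * G U1 a1 V1 b1 l \<le> t * (re_trace (mat_adjoint X * A1 * X) + 1 / l * re_trace (mat_adjoint Y * Y * B1))"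
      using parallel_sum_lower[OF e1 f1 K l X(1)] t unfolding G_def Y_def by (intro mult_left_mono) auto
    moreover have "(1 - t) * G U2 a2 V2 b2 l \<le> (1 - t) * (re_trace (mat_adjoint X * A2 * X) + 1 / l * re_trace (mat_adjoint Y * Y * B2))"
      using parallel_sum_lower[OF e2 f2 K l X(1)] t unfolding G_def Y_def by (intro mult_left_mono) auto
    moreover have "t * (re_trace (mat_adjoint X * A1 * X) + 1 / l * re_trace (mat_adjoint Y * Y * B1)) +
       (1 - t) * (re_trace (mat_adjoint X * A2 * X) + 1 / l * re_trace (mat_adjoint Y * Y * B2)) = G U a V b l"
      unfolding X(2) Y_def[symmetric] 1 2 by (simp add: algebra_simps add_divide_distrib diff_divide_distrib)
    ultimately show ?thesis by linarith
  qed
  let ?g = "\<lambda>l. t * (indicator {0<..} l * (l powr (u - 1) * G U1 a1 V1 b1 l))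
       + (1 - t) * (indicator {0<..} l * (l powr (u - 1) * G U2 a2 V2 b2 l))"
  let ?L = "\<lambda>A B. re_trace (mat_adjoint K * mat_powr A (1 - u) * K * mat_powr B u)"
  have h1: "has_bochner_integral lborel ?g (t * (C * ?L A1 B1) + (1 - t) * (C * ?L A2 B2))"
    by (intro has_bochner_integral_add has_bochner_integral_mult_right int e1 e2 f1 f2)
  note h2 = int[OF e f]
  have "integral\<^sup>L lborel ?g \<le> integral\<^sup>L lborel (\<lambda>l. indicator {0<..} l * (l powr (u - 1) * G U a V b l))"
  proof (rule integral_mono)
    show "integrable lborel ?g" using h1 by (rule integrable.intros)
    show "integrable lborel (\<lambda>l. indicator {0<..} l * (l powr (u - 1) * G U a V b l))"
      using h2 by (rule integrable.intros)
    fix l :: real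
    show "?g l \<le> indicator {0<..} l * (l powr (u - 1) * G U a V b l)"
    proof (cases "0 < l")
      case True
      then show ?thesis
        using mult_left_mono[OF G[OF True], of "l powr (u - 1)"] by (simp add: algebra_simps)
    qed simp
  qed
  then have "t * (C * ?L A1 B1) + (1 - t) * (C * ?L A2 B2) \<le> C * ?L ?A ?B"
    unfolding has_bochner_integral_integral_eq[OF h1] has_bochner_integral_integral_eq[OF h2] .
  then have "C * (t * ?L A1 B1 + (1 - t) * ?L A2 B2) \<le> C * ?L ?A ?B" by (simp add: algebra_simps)
  then show ?thesis using C(1) by simp
qed

section \<open>Trace inequalities of Young type and Epstein's concavity theorem\<close>

lemma unitary_row_sum:
  assumes "unitary_mat n W" "i < n"
  shows "(\<Sum>j<n. (cmod (W $$ (i, j)))\<^sup>2) = 1"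
proof -
  note Wc = unitary_carrier[OF assms(1)]
  have "complex_of_real (\<Sum>j<n. (cmod (W $$ (i, j)))\<^sup>2) = (\<Sum>j<n. W $$ (i, j) * mat_adjoint W $$ (j, i))"
    unfolding of_real_sum complex_norm_square using Wc assms(2) by (intro sum.cong) auto
  also have "\<dots> = (W * mat_adjoint W) $$ (i, i)"
    by (rule mult_index[symmetric]) (use Wc assms in auto)
  also have "\<dots> = 1" using assms by (simp add: unitary_right)
  finally show ?thesis by (metis of_real_1 of_real_eq_iff)
qed

lemma unitary_column_sum:
  assumes "unitary_mat n W" "j < n"
  shows "(\<Sum>i<n. (cmod (W $$ (i, j)))\<^sup>2) = 1"
  using unitary_row_sum[OF unitary_adj[OF assms(1)] assms(2)] unitary_carrier[OF assms(1)] assms(2) by simp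

text \<open>The weights \<open>\<bar>\<langle>u\<^sub>i, v\<^sub>j\<rangle>\<bar>\<^sup>2\<close> of two eigenbases form a doubly stochastic matrix, so that
  scalar inequalities of this shape pass to traces.\<close>
lemma Klein_powr:
  assumes A: "pos_def_mat n A" and B: "pos_def_mat n B"
    and le: "\<And>a b. 0 < a \<Longrightarrow> 0 < b \<Longrightarrow> c * (a powr r * b powr s) \<le> \<alpha> * a powr v + \<beta> * b powr w"
  shows "c * re_trace (mat_powr A r * mat_powr B s) \<le> \<alpha> * re_trace (mat_powr A v) + \<beta> * re_trace (mat_powr B w)"
proof -
  obtain U a where e: "eig n A U a" using pos_def_eig[OF A] by blast
  obtain V b where f: "eig n B V b" using pos_def_eig[OF B] by blast
  define W where "W = mat_adjoint U * V"
  have W: "unitary_mat n W" unfolding W_def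
    by (intro unitary_mult unitary_adj eigD(1)[OF e] eigD(1)[OF f])
  have one: "mat_adjoint U * 1\<^sub>m n * V = W" using eigD(4)[OF e] eigD(4)[OF f] by (simp add: W_def)
  have "c * re_trace (mat_powr A r * mat_powr B s)
    = (\<Sum>i<n. \<Sum>j<n. c * (a i powr r * b j powr s) * (cmod (W $$ (i, j)))\<^sup>2)"
    using re_trace_two_eig[OF e f, of "1\<^sub>m n" r s, unfolded one]
      left_mult_one_mat[OF powr_carrier[OF A]] right_mult_one_mat[OF powr_carrier[OF A]]
    by (simp add: sum_distrib_left mult.assoc)
  also have "\<dots> \<le> (\<Sum>i<n. \<Sum>j<n. (\<alpha> * a i powr v + \<beta> * b j powr w) * (cmod (W $$ (i, j)))\<^sup>2)"
    by (intro sum_mono mult_right_mono le) (use eigD(2)[OF e] eigD(2)[OF f] in auto)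
  also have "\<dots> = (\<Sum>i<n. \<Sum>j<n. \<alpha> * a i powr v * (cmod (W $$ (i, j)))\<^sup>2) + (\<Sum>j<n. \<Sum>i<n. \<beta> * b j powr w * (cmod (W $$ (i, j)))\<^sup>2)"
    unfolding distrib_right sum.distrib by (subst (3) sum.swap) simp
  also have "\<dots> = \<alpha> * re_trace (mat_powr A v) + \<beta> * re_trace (mat_powr B w)"
    using re_trace_eig[OF eig_powr[OF e]] re_trace_eig[OF eig_powr[OF f]]
    by (simp add: sum_distrib_left[symmetric] unitary_row_sum[OF W] unitary_column_sum[OF W] mult.assoc)
  finally show ?thesis .
qed

text \<open>Convexity of x^r: the power at a lies above its tangent line at b.\<close>

lemma powr_Young_ge_one:
  fixes a b r :: real
  assumes "0 < a" "0 < b" "1 \<le> r"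
  shows "r * (a * b powr (r - 1)) \<le> a powr r + (r - 1) * b powr r"
proof -
  have "(a powr r) powr (1 / r) * (b powr r) powr ((r - 1) / r) \<le> 1 / r * a powr r + (r - 1) / r * b powr r"
    by (rule Youngs_inequality_0) (use assms in \<open>auto simp: field_simps\<close>)
  moreover have "(a powr r) powr (1 / r) * (b powr r) powr ((r - 1) / r) = a * b powr (r - 1)"
    using assms by (simp add: powr_powr)
  ultimately show ?thesis using assms by (simp add: field_simps)
qed

text \<open>The concave counterpart. Young's inequality is applied to a b^(r-1) and b^r with weights
  r and 1 - r, for which the powers of b cancel.\<close>

lemma powr_Young_le_one:
  fixes a b r :: real
  assumes "0 < a" "0 < b" "0 < r" "r \<le> 1"
  shows "a powr r \<le> r * (a * b powr (r - 1)) + (1 - r) * b powr r"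
proof -
  have "(a * b powr (r - 1)) powr r * (b powr r) powr (1 - r) \<le> r * (a * b powr (r - 1)) + (1 - r) * b powr r"
    by (rule Youngs_inequality_0) (use assms in auto)
  moreover have "(a * b powr (r - 1)) powr r * (b powr r) powr (1 - r) = a powr r * (b powr ((r - 1) * r) * b powr (r * (1 - r)))"
    using assms by (simp add: powr_powr powr_mult)
  moreover have "b powr ((r - 1) * r) * b powr (r * (1 - r)) = 1"
    using assms by (subst powr_add[symmetric]) (simp add: algebra_simps)
  ultimately show ?thesis by simp
qed

lemma re_trace_powr_ge:
  assumes "pos_def_mat n A" "pos_def_mat n B" "1 \<le> r"
  shows "r * re_trace (A * mat_powr B (r - 1)) - (r - 1) * re_trace (mat_powr B r) \<le> re_trace (mat_powr A r)"
  using Klein_powr[OF assms(1,2), of r 1 "r - 1" 1 r "r - 1" r] powr_Young_ge_one[OF _ _ assms(3)]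
  by (simp add: powr_one_mat[OF assms(1)])

lemma re_trace_powr_le:
  assumes "pos_def_mat n A" "pos_def_mat n B" "0 < r" "r \<le> 1"
  shows "re_trace (mat_powr A r) \<le> r * re_trace (A * mat_powr B (r - 1)) + (1 - r) * re_trace (mat_powr B r)"
proof -
  have "- r * re_trace (mat_powr A 1 * mat_powr B (r - 1)) \<le> - 1 * re_trace (mat_powr A r) + (1 - r) * re_trace (mat_powr B r)"
    by (rule Klein_powr[OF assms(1,2)]) (use powr_Young_le_one[OF _ _ assms(3,4)] in \<open>force simp: algebra_simps\<close>)
  then show ?thesis by (simp add: powr_one_mat[OF assms(1)])
qed

text \<open>Turns the two preceding bounds into variational formulas: at B = A they are
  equalities.\<close>

lemma re_trace_powr_attained:
  assumes "pos_def_mat n A"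
  shows "re_trace (A * mat_powr A (r - 1)) = re_trace (mat_powr A r)"
  using powr_mult_powr[OF assms, of 1 "r - 1"] by (simp add: powr_one_mat[OF assms])

text \<open>By \<open>re_trace_powr_ge\<close>, the affine functional that touches Tr A^r at the
  mixture lies below it at both endpoints.\<close>

lemma re_trace_powr_convex:
  assumes A: "pos_def_mat n A1" "pos_def_mat n A2" and t: "0 \<le> t" "t \<le> 1" and r: "1 \<le> r"
  shows "re_trace (mat_powr (mix t A1 A2) r) \<le> t * re_trace (mat_powr A1 r) + (1 - t) * re_trace (mat_powr A2 r)"
proof -
  let ?X = "mix t A1 A2"
  have X: "pos_def_mat n ?X" by (rule pos_def_mix[OF A t])
  note c = pos_def_carrier[OF A(1)] pos_def_carrier[OF A(2)] powr_carrier[OF X]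
  define T where "T = re_trace (mat_powr ?X r)"
  have "re_trace (?X * mat_powr ?X (r - 1)) = t * re_trace (A1 * mat_powr ?X (r - 1)) + (1 - t) * re_trace (A2 * mat_powr ?X (r - 1))"
    using c by (simp add: mult_mix(2)[of _ n] re_trace_mix[of _ n] carrier_mult)
  then have "r * T - (r - 1) * T
    = r * (t * re_trace (A1 * mat_powr ?X (r - 1)) + (1 - t) * re_trace (A2 * mat_powr ?X (r - 1))) - (r - 1) * T"
    unfolding T_def re_trace_powr_attained[OF X] by simp
  also have "\<dots> = t * (r * re_trace (A1 * mat_powr ?X (r - 1)) - (r - 1) * T)
     + (1 - t) * (r * re_trace (A2 * mat_powr ?X (r - 1)) - (r - 1) * T)"
    by (simp add: algebra_simps)
  also have "\<dots> \<le> t * re_trace (mat_powr A1 r) + (1 - t) * re_trace (mat_powr A2 r)"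
    unfolding T_def using re_trace_powr_ge[OF A(1) X r] re_trace_powr_ge[OF A(2) X r] t
    by (intro add_mono mult_left_mono) auto
  finally show ?thesis by (simp add: T_def algebra_simps)
qed

lemma mix_same: "A \<in> carrier_mat n n \<Longrightarrow> mix t A A = A"
  by (rule eq_matI) (auto simp: mix_def algebra_simps)

text \<open>Lieb's theorem with a constant second argument: Y is written as B^u for u = 1 - q, with
  the same B at both ends. The linear case q = 1 stands apart because Lieb's theorem has u >
  0.\<close>

lemma re_trace_powr_weighted_concave:
  assumes A: "pos_def_mat n A1" "pos_def_mat n A2" and Y: "pos_def_mat n Y"
    and K: "K \<in> carrier_mat n n" and t: "0 \<le> t" "t \<le> 1" and q: "0 < q" "q \<le> 1"
  shows "t * re_trace (mat_adjoint K * mat_powr A1 q * K * Y) + (1 - t) * re_trace (mat_adjoint K * mat_powr A2 q * K * Y)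
    \<le> re_trace (mat_adjoint K * mat_powr (mix t A1 A2) q * K * Y)"
proof (cases "q = 1")
  case True
  have "pos_def_mat n (mix t A1 A2)" by (rule pos_def_mix[OF A t])
  then show ?thesis
    using True A Y K pos_def_carrier[OF A(1)] pos_def_carrier[OF A(2)] pos_def_carrier[OF Y]
    by (simp add: powr_one_mat[of n] mult_mix[of _ n] re_trace_mix[of _ n] carrier_mult)
next
  case False
  define u where "u = 1 - q"
  have u: "0 < u" "u < 1" "1 - u = q" using q False by (auto simp: u_def)
  define B where "B = mat_powr Y (1 / u)"
  have B: "pos_def_mat n B" unfolding B_def by (rule pos_def_powr[OF Y])
  have BY: "mat_powr B u = Y" unfolding B_def using u by (simp add: powr_powr_mat[OF Y] powr_one_mat[OF Y])
  show ?thesis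
    using Lieb_concavity[OF A B B K t u(1,2)] pos_def_carrier[OF B] by (simp add: u BY mix_same[of _ n])
qed

text \<open>For r <= 1 the trace is a minimum of functionals concave in A, so the test matrix can
  stay fixed at the optimum for the mixture. For r > 1 it is a maximum: the test matrix has to move
  with A, and concavity in both together is needed.\<close>

theorem Epstein_concavity:
  assumes A: "pos_def_mat n A1" "pos_def_mat n A2"
    and K: "K \<in> carrier_mat n n" "L \<in> carrier_mat n n" "L * K = 1\<^sub>m n"
    and t: "0 \<le> t" "t \<le> 1" and q: "0 < q" "q \<le> 1" and r: "0 < r" "r * q \<le> 1"
  shows "t * re_trace (mat_powr (mat_adjoint K * mat_powr A1 q * K) r)
      + (1 - t) * re_trace (mat_powr (mat_adjoint K * mat_powr A2 q * K) r)
    \<le> re_trace (mat_powr (mat_adjoint K * mat_powr (mix t A1 A2) q * K) r)"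
proof -
  define M where "M A = mat_adjoint K * mat_powr A q * K" for A
  have M: "pos_def_mat n (M A)" if "pos_def_mat n A" for A
    unfolding M_def by (rule pos_def_congr[OF pos_def_powr[OF that] K])
  let ?A = "mix t A1 A2"
  have A0: "pos_def_mat n ?A" by (rule pos_def_mix[OF A t])
  show ?thesis
  proof (cases "r \<le> 1")
    case True
    define Y where "Y = mat_powr (M ?A) (r - 1)"
    define T where "T = re_trace (mat_powr (M ?A) r)"
    have Y: "pos_def_mat n Y" unfolding Y_def by (rule pos_def_powr[OF M[OF A0]])
    have "t * re_trace (M A1 * Y) + (1 - t) * re_trace (M A2 * Y) \<le> re_trace (M ?A * Y)"
      unfolding M_def by (rule re_trace_powr_weighted_concave[OF A Y K(1) t q])
    also have "\<dots> = T" unfolding Y_def T_def by (rule re_trace_powr_attained[OF M[OF A0]])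
    finally have 1: "t * re_trace (M A1 * Y) + (1 - t) * re_trace (M A2 * Y) \<le> T" .
    have "t * re_trace (mat_powr (M A1) r) + (1 - t) * re_trace (mat_powr (M A2) r)
      \<le> t * (r * re_trace (M A1 * Y) + (1 - r) * T) + (1 - t) * (r * re_trace (M A2 * Y) + (1 - r) * T)"
      unfolding Y_def T_def
      using re_trace_powr_le[OF M[OF A(1)] M[OF A0] r(1) True] re_trace_powr_le[OF M[OF A(2)] M[OF A0] r(1) True] t
      by (intro add_mono mult_left_mono) auto
    also have "\<dots> = r * (t * re_trace (M A1 * Y) + (1 - t) * re_trace (M A2 * Y)) + (1 - r) * T"
      by (simp add: algebra_simps)
    also have "\<dots> \<le> r * T + (1 - r) * T" using 1 r by simp
    finally show ?thesis by (simp add: T_def M_def algebra_simps)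
  next
    case False
    then have r1: "1 < r" by simp
    have q1: "q < 1" using r r1 q by (metis less_le mult.commute mult_1 not_le)
    text \<open>The substitution \<open>X = Y\<^sup>a\<close> makes the exponents in \<open>Tr (M X\<^bsup>r-1\<^esup>)\<close> add up to one,
      so that Lieb's theorem applies to the variational formula.\<close>
    define a where "a = (1 - q) / (r - 1)"
    have a: "0 < a" "a * (r - 1) = 1 - q" unfolding a_def using q1 r1 by auto
    \<comment> \<open>Here r q <= 1 enters: it amounts to q <= a, hence to 1 <= a r, and makes Tr
      Y^(a r) convex.\<close>
    have ar: "1 \<le> a * r"
    proof -
      have "a * r = 1 - q + a" using a(2) by (simp add: algebra_simps)
      moreover have "q \<le> a"
        unfolding a_def using r1 r by (simp add: le_divide_eq algebra_simps)
      ultimately show ?thesis by simp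
    qed
    \<comment> \<open>Chosen so that Y1^a and Y2^a are the maximisers M A1 and M A2 of the
      variational formula at the endpoints.\<close>
    define Y1 where "Y1 = mat_powr (M A1) (1 / a)"
    define Y2 where "Y2 = mat_powr (M A2) (1 / a)"
    have Y: "pos_def_mat n Y1" "pos_def_mat n Y2" unfolding Y1_def Y2_def by (intro pos_def_powr M A)+
    let ?Y = "mix t Y1 Y2"
    have Y0: "pos_def_mat n ?Y" by (rule pos_def_mix[OF Y t])
    have u: "0 < 1 - q" "1 - q < 1" "1 - (1 - q) = q" using q q1 by auto
    have e: "1 / a * (1 - q) = r - 1" "1 / a * (a * r) = r" using a by (auto simp: field_simps)
    have Yq: "mat_powr Y1 (1 - q) = mat_powr (M A1) (r - 1)" "mat_powr Y2 (1 - q) = mat_powr (M A2) (r - 1)"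
      unfolding Y1_def Y2_def by (simp_all only: powr_powr_mat[OF M[OF A(1)]] powr_powr_mat[OF M[OF A(2)]] e)
    have Yar: "mat_powr Y1 (a * r) = mat_powr (M A1) r" "mat_powr Y2 (a * r) = mat_powr (M A2) r"
      unfolding Y1_def Y2_def by (simp_all only: powr_powr_mat[OF M[OF A(1)]] powr_powr_mat[OF M[OF A(2)]] e)
    define T1 where "T1 = re_trace (mat_powr (M A1) r)"
    define T2 where "T2 = re_trace (mat_powr (M A2) r)"
    have 1: "t * T1 + (1 - t) * T2 \<le> re_trace (M ?A * mat_powr ?Y (1 - q))"
      using Lieb_concavity[OF A Y K(1) t u(1,2)]
      unfolding u(3) Yq M_def[symmetric] re_trace_powr_attained[OF M[OF A(1)]] re_trace_powr_attained[OF M[OF A(2)]]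
        T1_def T2_def .
    have 2: "re_trace (mat_powr ?Y (a * r)) \<le> t * T1 + (1 - t) * T2"
      using re_trace_powr_convex[OF Y t ar] unfolding Yar T1_def T2_def .
    have "r * re_trace (M ?A * mat_powr (mat_powr ?Y a) (r - 1)) - (r - 1) * re_trace (mat_powr (mat_powr ?Y a) r)
       \<le> re_trace (mat_powr (M ?A) r)"
      by (rule re_trace_powr_ge[OF M[OF A0] pos_def_powr[OF Y0]]) (use r1 in simp)
    then have 3: "r * re_trace (M ?A * mat_powr ?Y (1 - q)) - (r - 1) * re_trace (mat_powr ?Y (a * r))
       \<le> re_trace (mat_powr (M ?A) r)"
      unfolding powr_powr_mat[OF Y0] a(2) .
    have "t * T1 + (1 - t) * T2 = r * (t * T1 + (1 - t) * T2) - (r - 1) * (t * T1 + (1 - t) * T2)"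
      by (simp add: algebra_simps)
    also have "\<dots> \<le> r * re_trace (M ?A * mat_powr ?Y (1 - q)) - (r - 1) * re_trace (mat_powr ?Y (a * r))"
      using 1 2 r1 by (intro diff_mono mult_left_mono) auto
    finally show ?thesis using 3 by (simp add: T1_def T2_def M_def)
  qed
qed

section \<open>The Araki--Lieb--Thirring and Hoelder inequalities\<close>

text \<open>Pinching: replacing \<open>A\<close> by the average of \<open>A\<close> and \<open>S A S\<close>, for a diagonal sign matrix \<open>S\<close> with
  a single negative entry, clears one row and one column; the concave function
  \<open>A \<mapsto> Tr (D\<^bsup>1/2\<^esup> A\<^bsup>1/s\<^esup> D\<^bsup>1/2\<^esup>)\<^sup>s\<close> does not decrease.\<close>
lemma pinching_bound:
  assumes s: "1 < s" and d: "\<And>i. i < n \<Longrightarrow> 0 < d i" and A: "pos_def_mat n A" and k: "k \<le> n"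
    and clear: "\<And>i j. i < n \<Longrightarrow> j < n \<Longrightarrow> i \<noteq> j \<Longrightarrow> i < k \<or> j < k \<Longrightarrow> A $$ (i, j) = 0"
  shows "re_trace (mat_powr (real_diag n (\<lambda>i. d i powr (1/2)) * mat_powr A (1/s) * real_diag n (\<lambda>i. d i powr (1/2))) s)
    \<le> (\<Sum>i<n. d i powr s * Re (A $$ (i, i)))"
  using k A clear
proof (induction k arbitrary: A rule: inc_induct)
  \<comment> \<open>The induction descends from k = n, where A is diagonal and the bound is an
    equality; the step from Suc k to k clears row and column k.\<close>
  case base
  note A = base.prems(1)
  note Ac = pos_def_carrier[OF A]
  define a where "a i = Re (A $$ (i, i))" for i
  have areal: "A $$ (i, i) = complex_of_real (a i)" if "i < n" for i
    using adj_index[of i A i] pos_def_adj[OF A] Ac that by (simp add: a_def complex_eq_iff)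
  have Adg: "A = real_diag n a"
    by (rule eq_matI) (use Ac base.prems(2) areal in auto)
  have apos: "0 < a i" if i: "i < n" for i
  proof -
    have "col (1\<^sub>m n :: complex mat) i \<noteq> 0\<^sub>v n"
      using i by (auto simp: vec_eq_iff dest!: arg_cong[of _ _ "\<lambda>v. v $ i"])
    moreover have "conjugate (col (1\<^sub>m n) i) \<bullet> (A *\<^sub>v col (1\<^sub>m n) i) = A $$ (i, i)"
      using quadform_col[OF Ac one_carrier_mat i] Ac i by simp
    moreover have "col (1\<^sub>m n :: complex mat) i \<in> carrier_vec n" using i by auto
    ultimately show ?thesis using A by (metis a_def pos_def_mat_def)
  qed
  have e: "eig n A (1\<^sub>m n) a" using apos Adg by (simp add: eig_def unitary_one)
  have "real_diag n (\<lambda>i. d i powr (1/2)) * mat_powr A (1/s) * real_diag n (\<lambda>i. d i powr (1/2))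
     = real_diag n (\<lambda>i. d i powr (1/2) * a i powr (1/s) * d i powr (1/2))"
    unfolding mat_powr_eig[OF e] by (simp add: real_diag_mult)
  also have "\<dots> = real_diag n (\<lambda>i. d i * a i powr (1/s))"
  proof (rule real_diag_cong)
    fix i assume "i < n"
    have "d i powr (1/2) * d i powr (1/2) = d i" using d[OF \<open>i < n\<close>] by (simp add: powr_add[symmetric])
    then show "d i powr (1/2) * a i powr (1/s) * d i powr (1/2) = d i * a i powr (1/s)"
      by (metis mult.assoc mult.commute)
  qed
  finally have X: "real_diag n (\<lambda>i. d i powr (1/2)) * mat_powr A (1/s) * real_diag n (\<lambda>i. d i powr (1/2)) = real_diag n (\<lambda>i. d i * a i powr (1/s))" .
  have e2: "eig n (real_diag n (\<lambda>i. d i * a i powr (1/s))) (1\<^sub>m n) (\<lambda>i. d i * a i powr (1/s))"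
  proof -
    have "0 < d i * a i powr (1/s)" if "i < n" for i using apos[OF that] d[OF that] by simp
    then show ?thesis by (auto simp: eig_def unitary_one)
  qed
  have "re_trace (mat_powr (real_diag n (\<lambda>i. d i * a i powr (1/s))) s) = (\<Sum>i<n. (d i * a i powr (1/s)) powr s)"
    by (rule re_trace_eig[OF eig_powr[OF e2]])
  also have "\<dots> = (\<Sum>i<n. d i powr s * a i)"
  proof (intro sum.cong refl)
    fix i assume "i \<in> {..<n}"
    then show "(d i * a i powr (1/s)) powr s = d i powr s * a i"
      using apos[of i] s by (simp add: powr_mult powr_powr)
  qed
  finally show ?case unfolding X a_def by simp
next
  case (step k)
  note A = step.prems(1)
  note Ac = pos_def_carrier[OF A]
  define \<sigma> :: "nat \<Rightarrow> real" where "\<sigma> i = (if i = k then -1 else 1)" for i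
  define S where "S = real_diag n \<sigma>"
  define D where "D = real_diag n (\<lambda>i. d i powr (1/2))"
  have Sc: "S \<in> carrier_mat n n" "mat_adjoint S = S" by (auto simp: S_def)
  have SS: "S * S = 1\<^sub>m n" unfolding S_def real_diag_mult real_diag_one[symmetric] by (rule real_diag_cong) (auto simp: \<sigma>_def)
  have Su: "unitary_mat n S" using Sc SS by (simp add: unitary_mat_def)
  have Dc: "D \<in> carrier_mat n n" "mat_adjoint D = D" by (auto simp: D_def)
  have DS: "D * S = S * D" unfolding D_def S_def real_diag_mult by (simp add: mult.commute)
  have DSc: "D * (S * Z) = S * (D * Z)" if "Z \<in> carrier_mat n n" for Z
    using DS that Sc Dc by (metis assoc3)
  define Di where "Di = real_diag n (\<lambda>i. d i powr (-(1/2)))"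
  have Di: "Di \<in> carrier_mat n n" "Di * D = 1\<^sub>m n"
    unfolding Di_def D_def real_diag_mult real_diag_one[symmetric]
    by (auto intro!: real_diag_cong simp: powr_add[symmetric]) (use d in force)
  define f where "f X = re_trace (mat_powr (D * mat_powr X (1/s) * D) s)" for X
  define A' where "A' = S * A * S"
  have A': "pos_def_mat n A'" unfolding A'_def using pos_def_congr[OF A Sc(1) Sc(1) SS] Sc by simp
  \<comment> \<open>Conjugation by the unitary S passes through powers and, since diagonal matrices
    commute, through D; the trace does not see it.\<close>
  have fA': "f A' = f A"
  proof -
    have "mat_powr A' (1/s) = S * mat_powr A (1/s) * S"
      using powr_unitary[OF A Su] Sc by (simp add: A'_def)
    then have "D * mat_powr A' (1/s) * D = S * (D * mat_powr A (1/s) * D) * mat_adjoint S"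
      using Sc Dc powr_carrier[OF A] by (simp add: assoc3[of _ n] carrier_mult DS DSc)
    moreover have "pos_def_mat n (D * mat_powr A (1/s) * D)"
      using pos_def_congr[OF pos_def_powr[OF A] Dc(1) Di] Dc by simp
    ultimately show ?thesis unfolding f_def
      using powr_unitary[OF _ Su] re_trace_unitary[OF powr_carrier Su] by simp
  qed
  let ?B = "mix (1/2) A A'"
  have B: "pos_def_mat n ?B" by (rule pos_def_mix[OF A A']) auto
  have ent: "A' $$ (i, j) = complex_of_real (\<sigma> i * \<sigma> j) * A $$ (i, j)" if "i < n" "j < n" for i j
    unfolding A'_def S_def using that Ac
    by (simp add: mult_real_diag_index[of _ n n] real_diag_mult_index[of _ n n] carrier_mult del: index_mult_mat(1))
  \<comment> \<open>Conjugation by S flips the sign of the off-diagonal entries in row and column k;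
    averaging removes exactly these.\<close>
  have Bent: "?B $$ (i, j) = (if (i = k) = (j = k) then A $$ (i, j) else 0)" if "i < n" "j < n" for i j
    unfolding mix_def using that Ac pos_def_carrier[OF A'] ent[OF that]
    by (auto simp: \<sigma>_def algebra_simps)
  have "f A = 1/2 * f A + (1 - 1/2) * f A'" using fA' by simp
  \<comment> \<open>Epstein's theorem on the boundary r q = 1, with q = 1/s and r = s.\<close>
  also have "\<dots> \<le> f ?B"
    unfolding f_def using Epstein_concavity[OF A A' Dc(1) Di, of "1/2" "1/s" s] s Dc by simp
  also have "\<dots> \<le> (\<Sum>i<n. d i powr s * Re (?B $$ (i, i)))"
    unfolding f_def D_def
  proof (rule step.IH[OF B])
    fix i j assume ij: "i < n" "j < n" "i \<noteq> j" "i < Suc k \<or> j < Suc k"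
    show "?B $$ (i, j) = 0"
      using Bent[OF ij(1,2)] step.prems(2)[OF ij(1-3)] ij(3,4) by (auto simp: less_Suc_eq)
  qed
  also have "\<dots> = (\<Sum>i<n. d i powr s * Re (A $$ (i, i)))"
    by (intro sum.cong) (auto simp: Bent)
  finally show ?case unfolding f_def D_def .
qed

text \<open>In an eigenbasis of P, where A represents Q^s, the left side is the quantity bounded by
  pinching with \<open>k = 0\<close>, that is, with no entry assumed to vanish. The resulting sum
  over the diagonal of A is the trace of P^s Q^s.\<close>

theorem Araki_Lieb_Thirring:
  assumes P: "pos_def_mat n P" and Q: "pos_def_mat n Q" and s: "1 < s"
  shows "re_trace (mat_powr (mat_powr P (1/2) * Q * mat_powr P (1/2)) s) \<le> re_trace (mat_powr P s * mat_powr Q s)"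
proof -
  obtain U d where e: "eig n P U d" using pos_def_eig[OF P] by blast
  note D = eigD[OF e]
  note Qc = pos_def_carrier[OF Q]
  note c = D(4) Qc powr_carrier[OF Q]
  define A where "A = mat_adjoint U * mat_powr Q s * U"
  have A: "pos_def_mat n A" unfolding A_def
    by (rule pos_def_congr[OF pos_def_powr[OF Q] D(4) _ unitary_left[OF D(1)]]) (use D in auto)
  have As: "mat_powr A (1/s) = mat_adjoint U * Q * U"
    using powr_unitary[OF pos_def_powr[OF Q] unitary_adj[OF D(1)], of s "1/s"] s
    by (simp add: A_def powr_powr_mat[OF Q] powr_one_mat[OF Q])
  define R where "R r = real_diag n (\<lambda>i. d i powr r)" for r
  have R: "R r \<in> carrier_mat n n" for r by (simp add: R_def)
  have "mat_powr P (1/2) * Q * mat_powr P (1/2) = U * (R (1/2) * mat_powr A (1/s) * R (1/2)) * mat_adjoint U"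
    unfolding mat_powr_eig[OF e] As R_def[symmetric] using c R
    by (simp add: assoc3[of _ n] carrier_mult)
  moreover have "pos_def_mat n (R (1/2) * mat_powr A (1/s) * R (1/2))"
  proof -
    have "R (-(1/2)) * R (1/2) = 1\<^sub>m n"
      unfolding R_def real_diag_mult real_diag_one[symmetric] by (rule real_diag_cong) (use D(2) in \<open>force simp: powr_add[symmetric]\<close>)
    then show ?thesis using pos_def_congr[OF pos_def_powr[OF A] R R] by (simp add: R_def)
  qed
  ultimately have "re_trace (mat_powr (mat_powr P (1/2) * Q * mat_powr P (1/2)) s)
     = re_trace (mat_powr (R (1/2) * mat_powr A (1/s) * R (1/2)) s)"
    using powr_unitary[OF _ D(1)] re_trace_unitary[OF powr_carrier D(1)] by simp
  also have "\<dots> \<le> (\<Sum>i<n. d i powr s * Re (A $$ (i, i)))"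
    unfolding R_def by (rule pinching_bound[OF s D(2) A, where k = 0]) auto
  also have "\<dots> = re_trace (R s * A)"
    unfolding R_def using pos_def_carrier[OF A]
    by (subst re_trace_sum[of _ n]) (auto simp: carrier_mult real_diag_mult_index[of _ n n] simp del: index_mult_mat(1))
  also have "\<dots> = re_trace (R s * (mat_adjoint U * mat_powr Q s) * U)"
    unfolding A_def using c R by (simp add: assoc3[of _ n] carrier_mult)
  also have "\<dots> = re_trace (U * (R s * (mat_adjoint U * mat_powr Q s)))"
    by (rule re_trace_comm[of _ n n]) (use c R in \<open>auto simp: carrier_mult\<close>)
  also have "\<dots> = re_trace (mat_powr P s * mat_powr Q s)"
    unfolding mat_powr_eig[OF e, of s] R_def[symmetric] using c R by (simp add: assoc3[of _ n] carrier_mult)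
  finally show ?thesis .
qed

text \<open>The two matrices are X X^* and X^* X for X = P^(1/2) Q^(1/2).\<close>

lemma re_trace_sqrt_swap:
  assumes P: "pos_def_mat n P" and Q: "pos_def_mat n Q"
  shows "re_trace (mat_powr (mat_powr P (1/2) * Q * mat_powr P (1/2)) s)
    = re_trace (mat_powr (mat_powr Q (1/2) * P * mat_powr Q (1/2)) s)"
proof -
  note c = powr_carrier[OF P] powr_carrier[OF Q]
  define X where "X = mat_powr P (1/2) * mat_powr Q (1/2)"
  define Y where "Y = mat_powr Q (-(1/2)) * mat_powr P (-(1/2))"
  have half: "mat_powr P (1/2) * mat_powr P (1/2) = P" "mat_powr Q (1/2) * mat_powr Q (1/2) = Q"
    by (simp_all add: powr_mult_powr[OF P] powr_mult_powr[OF Q] powr_one_mat[OF P] powr_one_mat[OF Q])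
  have inv: "mat_powr P (-(1/2)) * mat_powr P (1/2) = 1\<^sub>m n" "mat_powr Q (-(1/2)) * mat_powr Q (1/2) = 1\<^sub>m n"
    by (simp_all add: powr_mult_powr[OF P] powr_mult_powr[OF Q] powr_zero_mat[OF P] powr_zero_mat[OF Q])
  have X: "X \<in> carrier_mat n n" "Y \<in> carrier_mat n n" unfolding X_def Y_def using c by (auto simp: carrier_mult)
  have YX: "Y * X = 1\<^sub>m n"
    unfolding X_def Y_def using c by (simp add: assoc3[of _ n] carrier_mult cancel_left[OF inv(1)] inv)
  have Xa: "mat_adjoint X = mat_powr Q (1/2) * mat_powr P (1/2)"
    unfolding X_def using c by (simp add: adj_mult[of _ n n _ n] adj_powr[OF P] adj_powr[OF Q])
  have "X * mat_adjoint X = mat_powr P (1/2) * (mat_powr Q (1/2) * mat_powr Q (1/2)) * mat_powr P (1/2)"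
    unfolding Xa unfolding X_def using c by (simp add: assoc3[of _ n] carrier_mult)
  moreover have "mat_adjoint X * X = mat_powr Q (1/2) * (mat_powr P (1/2) * mat_powr P (1/2)) * mat_powr Q (1/2)"
    unfolding Xa unfolding X_def using c by (simp add: assoc3[of _ n] carrier_mult)
  ultimately show ?thesis using re_trace_powr_swap[OF X YX, of s] half by simp
qed

text \<open>For \<open>s > 1\<close> the inequality reduces by Araki--Lieb--Thirring to commuting variables; for
  \<open>s \<le> 1\<close> one inserts \<open>P\<^bsup>s1/s\<^esup>\<close> into the variational formula.\<close>
lemma Hoelder_Young:
  assumes P: "pos_def_mat n P" and Q: "pos_def_mat n Q"
    and s: "0 < s" "0 < s1" "1 \<le> s2" "1 / s = 1 / s1 + 1 / s2"
  shows "re_trace (mat_powr (mat_powr P (1/2) * Q * mat_powr P (1/2)) s)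
    \<le> s / s1 * re_trace (mat_powr P s1) + s / s2 * re_trace (mat_powr Q s2)"
proof -
  have w: "s / s1 + s / s2 = 1" using arg_cong[OF s(4), of "\<lambda>x. s * x"] s(1) by (simp add: distrib_left)
  show ?thesis
  proof (cases "1 < s")
    case True
    have "1 * re_trace (mat_powr P s * mat_powr Q s) \<le> s / s1 * re_trace (mat_powr P s1) + s / s2 * re_trace (mat_powr Q s2)"
    proof (rule Klein_powr[OF P Q])
      fix a b :: real assume ab: "0 < a" "0 < b"
      have "(a powr s1) powr (s / s1) * (b powr s2) powr (s / s2) \<le> s / s1 * a powr s1 + s / s2 * b powr s2"
        by (rule Youngs_inequality_0) (use ab s w in auto)
      then show "1 * (a powr s * b powr s) \<le> s / s1 * a powr s1 + s / s2 * b powr s2"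
        using s by (simp add: powr_powr)
    qed
    then show ?thesis using Araki_Lieb_Thirring[OF P Q True] by simp
  next
    case False
    then have s1: "s \<le> 1" by simp
    note c = powr_carrier[OF P] powr_carrier[OF Q] pos_def_carrier[OF Q]
    define M where "M = mat_powr P (1/2) * Q * mat_powr P (1/2)"
    \<comment> \<open>The exponent of P that remains after cyclic rearrangement. Young's inequality
      with weights 1/s2 and 1 - 1/s2 turns P^x into P^s1.\<close>
    define x where "x = s1 * (1 - 1 / s2)"
    have M: "pos_def_mat n M"
      unfolding M_def using pos_def_congr[OF Q, of "mat_powr P (1/2)" "mat_powr P (-(1/2))"] P
      by (simp add: powr_mult_powr[OF P] powr_zero_mat[OF P])
    have x: "1 + s1 / s * (s - 1) = x"
    proof -
      have "1 / s2 = 1 / s - 1 / s1" using s(4) by simp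
      then show ?thesis unfolding x_def using s(1,2) by (simp add: field_simps)
    qed
    \<comment> \<open>The test matrix P^(s1/s) is what M equals in the commuting equality case P^s1
      = Q^s2, where P Q = P^(1 + s1/s2).\<close>
    have "re_trace (mat_powr M s) \<le> s * re_trace (M * mat_powr (mat_powr P (s1 / s)) (s - 1)) + (1 - s) * re_trace (mat_powr (mat_powr P (s1 / s)) s)"
      by (rule re_trace_powr_le[OF M pos_def_powr[OF P] s(1) s1])
    also have "mat_powr (mat_powr P (s1 / s)) s = mat_powr P s1" using s by (simp add: powr_powr_mat[OF P])
    also have "re_trace (M * mat_powr (mat_powr P (s1 / s)) (s - 1)) = re_trace (Q * mat_powr P x)"
    proof -
      have "M * mat_powr (mat_powr P (s1 / s)) (s - 1) = mat_powr P (1/2) * (Q * mat_powr P (1/2 + s1 / s * (s - 1)))"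
        unfolding M_def powr_powr_mat[OF P] using c
        by (simp add: assoc3[of _ n] carrier_mult powr_mult_powr[OF P])
      also have "re_trace \<dots> = re_trace (Q * mat_powr P (1/2 + s1 / s * (s - 1)) * mat_powr P (1/2))"
        by (rule re_trace_comm[of _ n n]) (use c in \<open>auto simp: carrier_mult\<close>)
      also have "Q * mat_powr P (1/2 + s1 / s * (s - 1)) * mat_powr P (1/2) = Q * mat_powr P x"
        using c by (simp add: assoc3[of _ n] powr_mult_powr[OF P] x[symmetric] add_ac)
      finally show ?thesis .
    qed
    also have "s * re_trace (Q * mat_powr P x) \<le> s * (1 / s2 * re_trace (mat_powr Q s2) + (1 - 1 / s2) * re_trace (mat_powr P s1))"
    proof (rule mult_left_mono)
      have "1 * re_trace (mat_powr Q 1 * mat_powr P x) \<le> 1 / s2 * re_trace (mat_powr Q s2) + (1 - 1 / s2) * re_trace (mat_powr P s1)"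
      proof (rule Klein_powr[OF Q P])
        fix a b :: real assume ab: "0 < a" "0 < b"
        have "(a powr s2) powr (1 / s2) * (b powr s1) powr (1 - 1 / s2) \<le> 1 / s2 * a powr s2 + (1 - 1 / s2) * b powr s1"
          by (rule Youngs_inequality_0) (use ab s in auto)
        then show "1 * (a powr 1 * b powr x) \<le> 1 / s2 * a powr s2 + (1 - 1 / s2) * b powr s1"
          using s ab by (simp add: powr_powr x_def)
      qed
      then show "re_trace (Q * mat_powr P x) \<le> 1 / s2 * re_trace (mat_powr Q s2) + (1 - 1 / s2) * re_trace (mat_powr P s1)"
        by (simp add: powr_one_mat[OF Q])
    qed (use s in auto)
    finally have "re_trace (mat_powr M s) \<le> (s - s / s2 + (1 - s)) * re_trace (mat_powr P s1) + s / s2 * re_trace (mat_powr Q s2)"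
      by (simp add: algebra_simps)
    also have "s - s / s2 + (1 - s) = s / s1" using w by simp
    finally show ?thesis unfolding M_def .
  qed
qed

section \<open>Sufficiency\<close>

text \<open>With P = Z^* \<alpha> Z and Q = Zi \<beta> Zi^*, the matrix X = \<alpha>^(1/2) Z Q^(1/2)
  has X X^* equal to the product on the left and X^* X = Q^(1/2) P Q^(1/2). So the trace on the left
  is that of the same expression in P and Q, for which \<open>Hoelder_Young\<close> holds.\<close>

lemma re_trace_powr_le_split:
  assumes \<alpha>: "pos_def_mat n \<alpha>" and \<beta>: "pos_def_mat n \<beta>"
    and Z: "Z \<in> carrier_mat n n" "Zi \<in> carrier_mat n n" "Zi * Z = 1\<^sub>m n"
    and s: "0 < s" "0 < s1" "1 \<le> s2" "1 / s = 1 / s1 + 1 / s2"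
  shows "re_trace (mat_powr (mat_powr \<alpha> (1/2) * \<beta> * mat_powr \<alpha> (1/2)) s)
    \<le> s / s1 * re_trace (mat_powr (mat_adjoint Z * \<alpha> * Z) s1) + s / s2 * re_trace (mat_powr (Zi * \<beta> * mat_adjoint Zi) s2)"
proof -
  have ZZi: "Z * Zi = 1\<^sub>m n" using right_inverse_commute[OF Z(3,2,1)] .
  have adj: "mat_adjoint Zi * mat_adjoint Z = 1\<^sub>m n" "mat_adjoint Z * mat_adjoint Zi = 1\<^sub>m n"
    using Z ZZi by (simp_all add: adj_mult[of _ n n _ n, symmetric])
  define P where "P = mat_adjoint Z * \<alpha> * Z"
  define Q where "Q = Zi * \<beta> * mat_adjoint Zi"
  have P: "pos_def_mat n P" unfolding P_def by (rule pos_def_congr[OF \<alpha> Z])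
  have Q: "pos_def_mat n Q"
    unfolding Q_def using pos_def_congr[OF \<beta>, of "mat_adjoint Zi" "mat_adjoint Z"] Z adj by simp
  note c = powr_carrier[OF \<alpha>] pos_def_carrier[OF \<alpha>] pos_def_carrier[OF \<beta>] powr_carrier[OF Q] Z
  define X where "X = mat_powr \<alpha> (1/2) * Z * mat_powr Q (1/2)"
  define Y where "Y = mat_powr Q (-(1/2)) * Zi * mat_powr \<alpha> (-(1/2))"
  have half: "mat_powr \<alpha> (1/2) * mat_powr \<alpha> (1/2) = \<alpha>" "mat_powr Q (1/2) * mat_powr Q (1/2) = Q"
    by (simp_all add: powr_mult_powr[OF \<alpha>] powr_mult_powr[OF Q] powr_one_mat[OF \<alpha>] powr_one_mat[OF Q])
  have inv: "mat_powr \<alpha> (-(1/2)) * mat_powr \<alpha> (1/2) = 1\<^sub>m n" "mat_powr Q (-(1/2)) * mat_powr Q (1/2) = 1\<^sub>m n"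
    by (simp_all add: powr_mult_powr[OF \<alpha>] powr_mult_powr[OF Q] powr_zero_mat[OF \<alpha>] powr_zero_mat[OF Q])
  have X: "X \<in> carrier_mat n n" "Y \<in> carrier_mat n n" unfolding X_def Y_def using c by (auto simp: carrier_mult)
  have YX: "Y * X = 1\<^sub>m n"
    unfolding X_def Y_def using c
    by (simp add: assoc3[of _ n] carrier_mult cancel_left[OF inv(1)] cancel_left[OF Z(3)] inv)
  have Xa: "mat_adjoint X = mat_powr Q (1/2) * mat_adjoint Z * mat_powr \<alpha> (1/2)"
    unfolding X_def using c
    by (simp add: assoc3[of _ n] carrier_mult adj_mult[of _ n n _ n] adj_powr[OF \<alpha>] adj_powr[OF Q])
  have "X * mat_adjoint X = mat_powr \<alpha> (1/2) * (Z * (mat_powr Q (1/2) * mat_powr Q (1/2)) * mat_adjoint Z) * mat_powr \<alpha> (1/2)"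
    unfolding Xa unfolding X_def using c by (simp add: assoc3[of _ n] carrier_mult)
  also have "Z * (mat_powr Q (1/2) * mat_powr Q (1/2)) * mat_adjoint Z = \<beta>"
    unfolding half unfolding Q_def using c
    by (simp add: assoc3[of _ n] carrier_mult cancel_left[OF ZZi] adj)
  finally have XX: "X * mat_adjoint X = mat_powr \<alpha> (1/2) * \<beta> * mat_powr \<alpha> (1/2)" .
  have "mat_adjoint X * X = mat_powr Q (1/2) * (mat_adjoint Z * (mat_powr \<alpha> (1/2) * mat_powr \<alpha> (1/2)) * Z) * mat_powr Q (1/2)"
    unfolding Xa unfolding X_def using c by (simp add: assoc3[of _ n] carrier_mult)
  also have "mat_adjoint Z * (mat_powr \<alpha> (1/2) * mat_powr \<alpha> (1/2)) * Z = P"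
    unfolding half P_def ..
  finally have XX': "mat_adjoint X * X = mat_powr Q (1/2) * P * mat_powr Q (1/2)" .
  have "re_trace (mat_powr (mat_powr \<alpha> (1/2) * \<beta> * mat_powr \<alpha> (1/2)) s) = re_trace (mat_powr (mat_powr P (1/2) * Q * mat_powr P (1/2)) s)"
    using re_trace_powr_swap[OF X YX, of s] unfolding XX XX' re_trace_sqrt_swap[OF P Q] .
  also have "\<dots> \<le> s / s1 * re_trace (mat_powr P s1) + s / s2 * re_trace (mat_powr Q s2)"
    by (rule Hoelder_Young[OF P Q s])
  finally show ?thesis unfolding P_def Q_def .
qed

lemma re_trace_powr_split_attained:
  assumes \<alpha>: "pos_def_mat n \<alpha>" and \<beta>: "pos_def_mat n \<beta>"
    and s: "0 < s" "0 < s1" "1 \<le> s2" "1 / s = 1 / s1 + 1 / s2"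
  obtains Z Zi where "Z \<in> carrier_mat n n" "Zi \<in> carrier_mat n n" "Zi * Z = 1\<^sub>m n"
    "re_trace (mat_powr (mat_powr \<alpha> (1/2) * \<beta> * mat_powr \<alpha> (1/2)) s)
    = s / s1 * re_trace (mat_powr (mat_adjoint Z * \<alpha> * Z) s1) + s / s2 * re_trace (mat_powr (Zi * \<beta> * mat_adjoint Zi) s2)"
proof -
  have w: "s / s1 + s / s2 = 1" using arg_cong[OF s(4), of "\<lambda>x. s * x"] s(1) by (simp add: distrib_left)
  define M where "M = mat_powr \<alpha> (1/2) * \<beta> * mat_powr \<alpha> (1/2)"
  have M: "pos_def_mat n M"
    unfolding M_def using pos_def_congr[OF \<beta>, of "mat_powr \<alpha> (1/2)" "mat_powr \<alpha> (-(1/2))"] \<alpha>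
    by (simp add: powr_mult_powr[OF \<alpha>] powr_zero_mat[OF \<alpha>])
  \<comment> \<open>With the Z below, Z^* \<alpha> Z is M^(2 e) and Zi \<beta> Zi^* is M^(1 - 2 e).
    Taking 2 e = s / s1 makes the power s1 of the one and the power s2 of the other both equal to
    M^s, the equality case of Young's inequality.\<close>
  define e where "e = s / s1 / 2"
  define Z where "Z = mat_powr \<alpha> (-(1/2)) * mat_powr M e"
  define Zi where "Zi = mat_powr M (-e) * mat_powr \<alpha> (1/2)"
  note c = powr_carrier[OF \<alpha>] pos_def_carrier[OF \<alpha>] pos_def_carrier[OF \<beta>] powr_carrier[OF M]
  have inv: "mat_powr \<alpha> (1/2) * mat_powr \<alpha> (-(1/2)) = 1\<^sub>m n" "mat_powr M (-e) * mat_powr M e = 1\<^sub>m n"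
    by (simp_all add: powr_mult_powr[OF \<alpha>] powr_mult_powr[OF M] powr_zero_mat[OF \<alpha>] powr_zero_mat[OF M])
  have Z: "Z \<in> carrier_mat n n" "Zi \<in> carrier_mat n n" unfolding Z_def Zi_def using c by (auto simp: carrier_mult)
  have ZiZ: "Zi * Z = 1\<^sub>m n"
    unfolding Z_def Zi_def using c by (simp add: assoc3[of _ n] carrier_mult cancel_left[OF inv(1)] inv)
  have Za: "mat_adjoint Z = mat_powr M e * mat_powr \<alpha> (-(1/2))" "mat_adjoint Zi = mat_powr \<alpha> (1/2) * mat_powr M (-e)"
    unfolding Z_def Zi_def using c by (simp_all add: adj_mult[of _ n n _ n] adj_powr[OF \<alpha>] adj_powr[OF M])
  have "mat_powr \<alpha> (-(1/2)) * mat_powr \<alpha> 1 * mat_powr \<alpha> (-(1/2)) = 1\<^sub>m n"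
    by (simp add: powr_mult_powr[OF \<alpha>] powr_zero_mat[OF \<alpha>])
  then have mid: "mat_powr \<alpha> (-(1/2)) * \<alpha> * mat_powr \<alpha> (-(1/2)) = 1\<^sub>m n" by (simp add: powr_one_mat[OF \<alpha>])
  have "mat_adjoint Z * \<alpha> * Z = mat_powr M e * (mat_powr \<alpha> (-(1/2)) * \<alpha> * mat_powr \<alpha> (-(1/2))) * mat_powr M e"
    unfolding Za unfolding Z_def using c by (simp add: assoc3[of _ n] carrier_mult)
  also have "\<dots> = mat_powr M (s / s1)"
    unfolding mid by (simp add: right_mult_one_mat[OF powr_carrier[OF M]] powr_mult_powr[OF M] e_def)
  finally have 1: "mat_powr (mat_adjoint Z * \<alpha> * Z) s1 = mat_powr M s"
    using s by (simp add: powr_powr_mat[OF M])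
  have "Zi * \<beta> * mat_adjoint Zi = mat_powr M (-e) * mat_powr M 1 * mat_powr M (-e)"
    unfolding Za powr_one_mat[OF M] unfolding Zi_def M_def using c[unfolded M_def] by (simp add: assoc3[of _ n] carrier_mult)
  also have "\<dots> = mat_powr M (s / s2)"
  proof -
    have "- e + 1 + - e = s / s2" using w by (simp add: e_def)
    then show ?thesis by (simp only: powr_mult_powr[OF M])
  qed
  finally have 2: "mat_powr (Zi * \<beta> * mat_adjoint Zi) s2 = mat_powr M s"
    using s by (simp add: powr_powr_mat[OF M])
  have "re_trace (mat_powr M s) = s / s1 * re_trace (mat_powr M s) + s / s2 * re_trace (mat_powr M s)"
    unfolding distrib_right[symmetric] w by simp
  then show ?thesis using that[OF Z ZiZ] unfolding 1 2 M_def[symmetric] by simp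
qed

text \<open>Reading A^(q/2) as the square root of A^q brings \<open>Phi\<close> to the form of the
  split inequality, with \<alpha> = A^q and \<beta> = B^p.\<close>

lemma Phi_re_trace:
  assumes "pos_def_mat n A"
  shows "Phi p q s A B = re_trace (mat_powr (mat_powr (mat_powr A q) (1/2) * mat_powr B p * mat_powr (mat_powr A q) (1/2)) s)"
  by (simp add: Phi_def re_trace_def powr_powr_mat[OF assms])

lemma jointly_concave_Phi_iff:
  "jointly_concave_Phi n p q s \<longleftrightarrow> (\<forall>A1 B1 A2 B2 t.
     pos_def_mat n A1 \<and> pos_def_mat n B1 \<and> pos_def_mat n A2 \<and> pos_def_mat n B2 \<and> 0 \<le> t \<and> t \<le> 1 \<longrightarrow>
     t * Phi p q s A1 B1 + (1 - t) * Phi p q s A2 B2 \<le> Phi p q s (mix t A1 A2) (mix t B1 B2))"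
  by (simp add: jointly_concave_Phi_def mix_def)

lemma jointly_concave_PhiD:
  assumes "jointly_concave_Phi n p q s"
    and "pos_def_mat n A1" "pos_def_mat n B1" "pos_def_mat n A2" "pos_def_mat n B2" "0 \<le> t" "t \<le> 1"
  shows "t * Phi p q s A1 B1 + (1 - t) * Phi p q s A2 B2 \<le> Phi p q s (mix t A1 A2) (mix t B1 B2)"
  using assms unfolding jointly_concave_Phi_iff by blast

lemma jointly_concave_Phi_sufficient:
  assumes p: "0 < p" "p \<le> 1" and q: "0 < q" "q \<le> 1" and s: "0 < s" "s \<le> 1 / (p + q)"
  shows "jointly_concave_Phi n p q s"
  unfolding jointly_concave_Phi_iff
proof (intro allI impI, elim conjE)
  fix A1 B1 A2 B2 and t :: real
  assume pd: "pos_def_mat n A1" "pos_def_mat n B1" "pos_def_mat n A2" "pos_def_mat n B2" and t: "0 \<le> t" "t \<le> 1"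
  let ?A = "mix t A1 A2" and ?B = "mix t B1 B2"
  have A: "pos_def_mat n ?A" and B: "pos_def_mat n ?B" using pos_def_mix pd t by auto
  define s1 where "s1 = 1 / (1 / s - p)"
  define s2 where "s2 = 1 / p"
  have "p + q \<le> 1 / s" using s p q by (simp add: field_simps)
  then have q1: "q \<le> 1 / s - p" by simp
  have s12: "0 < s1" "1 \<le> s2" "1 / s = 1 / s1 + 1 / s2" using q1 p q by (auto simp: s1_def s2_def)
  have sq: "s1 * q \<le> 1" using q1 q by (simp add: s1_def)
  have sp: "s2 * p \<le> 1" "0 < s2" using p by (auto simp: s2_def)
  \<comment> \<open>This split is optimal for the mixture and stays fixed from here on, so that
    \<open>E1\<close> and \<open>E2\<close> depend on one variable each.\<close>
  obtain Z Zi where Z: "Z \<in> carrier_mat n n" "Zi \<in> carrier_mat n n" "Zi * Z = 1\<^sub>m n"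
    and opt: "Phi p q s ?A ?B = s / s1 * re_trace (mat_powr (mat_adjoint Z * mat_powr ?A q * Z) s1)
      + s / s2 * re_trace (mat_powr (Zi * mat_powr ?B p * mat_adjoint Zi) s2)"
    using re_trace_powr_split_attained[OF pos_def_powr[OF A] pos_def_powr[OF B] s(1) s12]
    unfolding Phi_re_trace[OF A] by metis
  define E1 where "E1 A = re_trace (mat_powr (mat_adjoint Z * mat_powr A q * Z) s1)" for A
  define E2 where "E2 B = re_trace (mat_powr (Zi * mat_powr B p * mat_adjoint Zi) s2)" for B
  have le: "Phi p q s A B \<le> s / s1 * E1 A + s / s2 * E2 B" if "pos_def_mat n A" "pos_def_mat n B" for A B
    unfolding Phi_re_trace[OF that(1)] E1_def E2_def
    by (rule re_trace_powr_le_split[OF pos_def_powr[OF that(1)] pos_def_powr[OF that(2)] Z s(1) s12])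
  have E1: "t * E1 A1 + (1 - t) * E1 A2 \<le> E1 ?A"
    unfolding E1_def by (rule Epstein_concavity[OF pd(1,3) Z t q s12(1) sq])
  have adj: "mat_adjoint Zi \<in> carrier_mat n n" "mat_adjoint Z \<in> carrier_mat n n" "mat_adjoint Z * mat_adjoint Zi = 1\<^sub>m n"
    using Z by (simp_all add: adj_mult[of _ n n _ n, symmetric])
  have E2: "t * E2 B1 + (1 - t) * E2 B2 \<le> E2 ?B"
    unfolding E2_def using Epstein_concavity[OF pd(2,4) adj t p sp(2,1)] by simp
  have "t * Phi p q s A1 B1 + (1 - t) * Phi p q s A2 B2
    \<le> t * (s / s1 * E1 A1 + s / s2 * E2 B1) + (1 - t) * (s / s1 * E1 A2 + s / s2 * E2 B2)"
    by (intro add_mono mult_left_mono le pd) (use t in auto)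
  also have "\<dots> = s / s1 * (t * E1 A1 + (1 - t) * E1 A2) + s / s2 * (t * E2 B1 + (1 - t) * E2 B2)"
    by (simp only: distrib_left mult_ac add_ac)
  also have "\<dots> \<le> s / s1 * E1 ?A + s / s2 * E2 ?B"
    by (intro add_mono mult_left_mono E1 E2) (use s(1) s12 sp in auto)
  also have "\<dots> = Phi p q s ?A ?B" unfolding opt E1_def E2_def ..
  finally show "t * Phi p q s A1 B1 + (1 - t) * Phi p q s A2 B2 \<le> Phi p q s ?A ?B" .
qed

section \<open>Necessity\<close>

lemma Phi_swap:
  assumes "pos_def_mat n A" "pos_def_mat n B"
  shows "Phi p q s A B = Phi q p s B A"
  unfolding Phi_re_trace[OF assms(1)] Phi_re_trace[OF assms(2)]
  by (rule re_trace_sqrt_swap[OF pos_def_powr[OF assms(1)] pos_def_powr[OF assms(2)]])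

lemma jointly_concave_Phi_swap:
  assumes "jointly_concave_Phi n p q s"
  shows "jointly_concave_Phi n q p s"
  using assms unfolding jointly_concave_Phi_iff by (metis Phi_swap pos_def_mix)

lemma mix_real_diag: "mix t (real_diag n a) (real_diag n b) = real_diag n (\<lambda>i. t * a i + (1 - t) * b i)"
  by (rule eq_matI) (auto simp: mix_def)

lemma eig_real_diag: "(\<And>i. i < n \<Longrightarrow> 0 < d i) \<Longrightarrow> eig n (real_diag n d) (1\<^sub>m n) d"
  by (simp add: eig_def unitary_one)

section \<open>Scalar test cases\<close>

lemma Phi_scalar:
  assumes "0 < a" "0 < b"
  shows "Phi p q s (real_diag 1 (\<lambda>_. a)) (real_diag 1 (\<lambda>_. b)) = a powr (q * s) * b powr (p * s)"
proof -
  have "mat_powr (real_diag 1 (\<lambda>_. a)) (q/2) * mat_powr (real_diag 1 (\<lambda>_. b)) p * mat_powr (real_diag 1 (\<lambda>_. a)) (q/2)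
    = real_diag 1 (\<lambda>_. a powr (q/2) * b powr p * a powr (q/2))"
    using mat_powr_eig[OF eig_real_diag[of 1 "\<lambda>_. a"]] mat_powr_eig[OF eig_real_diag[of 1 "\<lambda>_. b"]] assms
    by (simp add: real_diag_mult)
  also have "a powr (q/2) * b powr p * a powr (q/2) = a powr q * b powr p"
    using powr_add[of a "q/2" "q/2"] by simp
  finally have "Phi p q s (real_diag 1 (\<lambda>_. a)) (real_diag 1 (\<lambda>_. b)) = re_trace (mat_powr (real_diag 1 (\<lambda>_. a powr q * b powr p)) s)"
    by (simp add: Phi_def re_trace_def)
  also have "\<dots> = (a powr q * b powr p) powr s"
    using re_trace_eig[OF eig_powr[OF eig_real_diag[of 1 "\<lambda>_. a powr q * b powr p"]]] assms by simp
  also have "\<dots> = a powr (q * s) * b powr (p * s)" by (simp add: powr_mult powr_powr)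
  finally show ?thesis .
qed

lemma jointly_concave_Phi_scalar:
  assumes "jointly_concave_Phi 1 p q s" "0 < a" "0 < b" "0 < c" "0 < d"
  shows "a powr (q * s) * b powr (p * s) + c powr (q * s) * d powr (p * s)
    \<le> 2 * (((a + c) / 2) powr (q * s) * ((b + d) / 2) powr (p * s))"
proof -
  have pd: "pos_def_mat 1 (real_diag 1 (\<lambda>_. x))" if "0 < x" for x using that by (simp add: pos_def_real_diag)
  have "1/2 * Phi p q s (real_diag 1 (\<lambda>_. a)) (real_diag 1 (\<lambda>_. b)) + (1 - 1/2) * Phi p q s (real_diag 1 (\<lambda>_. c)) (real_diag 1 (\<lambda>_. d))
    \<le> Phi p q s (mix (1/2) (real_diag 1 (\<lambda>_. a)) (real_diag 1 (\<lambda>_. c))) (mix (1/2) (real_diag 1 (\<lambda>_. b)) (real_diag 1 (\<lambda>_. d)))"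
    by (rule jointly_concave_PhiD[OF assms(1)]) (use assms pd in auto)
  then show ?thesis
    unfolding mix_real_diag using assms(2-5) Phi_scalar[of "1/2 * a + (1 - 1/2) * c" "1/2 * b + (1 - 1/2) * d" p q s]
      Phi_scalar[OF assms(2,3), of p q s] Phi_scalar[OF assms(4,5), of p q s]
    by (simp add: add_divide_distrib)
qed

text \<open>Taking h with (1 + h)^g = 2 leaves the other summand as the strict excess; g > 1 keeps h
  below 1.\<close>

lemma powr_strictly_convex_witness:
  fixes g :: real
  assumes "1 < g"
  obtains h where "0 < h" "h < 1" "2 < (1 + h) powr g + (1 - h) powr g"
proof
  define h where "h = 2 powr (1 / g) - 1"
  have "2 powr (1 / g) < 2 powr (1::real)" using assms by (intro powr_less_mono) auto
  then show h1: "h < 1" by (simp add: h_def)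
  have "2 powr (0::real) < 2 powr (1 / g)" using assms by (intro powr_less_mono) auto
  then show "0 < h" by (simp add: h_def)
  have "(1 + h) powr g = 2" using assms by (simp add: h_def powr_powr)
  then show "2 < (1 + h) powr g + (1 - h) powr g" using h1 by simp
qed

lemma scalar_exponent_pos:
  assumes "jointly_concave_Phi 1 p q s" "q \<noteq> 0" "0 < s"
  shows "0 < q"
proof (rule ccontr)
  assume "\<not> 0 < q"
  then have neg: "q * s < 0" using assms(2,3) by (simp add: mult_neg_pos)
  \<comment> \<open>One endpoint alone contributes 4, while the midpoint of x and 2 exceeds 1, so
    twice its negative power is at most 2.\<close>
  define x where "x = 4 powr (1 / (q * s))"
  have x: "0 < x" "x powr (q * s) = 4" using neg by (auto simp: x_def powr_powr)
  have "((x + 2) / 2) powr (q * s) \<le> 1 powr (q * s)"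
    by (rule powr_mono2') (use x neg in auto)
  then have "((x + 2) / 2) powr (q * s) \<le> 1" by simp
  moreover have "4 + 2 powr (q * s) \<le> 2 * ((x + 2) / 2) powr (q * s)"
    using jointly_concave_Phi_scalar[OF assms(1) x(1), of 1 2 1] x(2) by simp
  moreover have "0 < (2::real) powr (q * s)" by simp
  ultimately show False by linarith
qed

text \<open>On pairs of equal scalars x, \<open>Phi\<close> is x^((p+q) s), and a positive exponent
  above one makes this strictly convex.\<close>

lemma scalar_exponent_sum:
  assumes "jointly_concave_Phi 1 p q s" "0 < s" "0 < p" "0 < q"
  shows "s \<le> 1 / (p + q)"
proof (rule ccontr)
  assume "\<not> s \<le> 1 / (p + q)"
  then have "1 < (q + p) * s" using assms by (simp add: field_simps)
  then obtain h where h: "0 < h" "h < 1" "2 < (1 + h) powr ((q + p) * s) + (1 - h) powr ((q + p) * s)"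
    using powr_strictly_convex_witness by blast
  show False
    using jointly_concave_Phi_scalar[OF assms(1), of "1 + h" "1 + h" "1 - h" "1 - h"] h
    by (simp add: powr_add[symmetric] distrib_right)
qed

text \<open>A diagonal entry in an orthonormal basis is a weighted mean of eigenvalues, so the
  largest eigenvalue is at least c, and its term alone gives the bound. This takes the place of a
  passage to a rank-one A in the counterexample below.\<close>

lemma re_trace_powr_lower_bound:
  assumes M: "pos_def_mat n M" and V: "unitary_mat n V" and j: "j < n" and s: "0 < s"
    and c: "0 \<le> c" "c \<le> Re ((mat_adjoint V * M * V) $$ (j, j))"
  shows "c powr s \<le> re_trace (mat_powr M s)"
proof -
  obtain W m where e: "eig n M W m" using pos_def_eig[OF M] by blast
  note D = eigD[OF e]
  define X where "X = mat_adjoint W * V"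
  have X: "unitary_mat n X" unfolding X_def by (intro unitary_mult unitary_adj D(1) V)
  note Xc = unitary_carrier[OF X]
  have "mat_adjoint V * M * V = mat_adjoint X * (real_diag n m * X)"
    unfolding X_def D(3) using D(4) unitary_carrier[OF V]
    by (simp add: assoc3[of _ n] carrier_mult adj_mult[of _ n n _ n])
  also have "\<dots> $$ (j, j) = (\<Sum>k<n. mat_adjoint X $$ (j, k) * (real_diag n m * X) $$ (k, j))"
    by (rule mult_index) (use Xc j in \<open>auto simp: carrier_mult\<close>)
  also have "\<dots> = (\<Sum>k<n. complex_of_real (m k * (cmod (X $$ (k, j)))\<^sup>2))"
    using Xc j unfolding of_real_mult complex_norm_square
    by (intro sum.cong) (auto simp: real_diag_mult_index[of _ n n] simp del: index_mult_mat(1))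
  finally have q: "Re ((mat_adjoint V * M * V) $$ (j, j)) = (\<Sum>k<n. m k * (cmod (X $$ (k, j)))\<^sup>2)" by simp
  define mx where "mx = Max (m ` {..<n})"
  have "mx \<in> m ` {..<n}" unfolding mx_def by (rule Max_in) (use j in auto)
  then obtain k where k: "k < n" "m k = mx" by auto
  have "c \<le> (\<Sum>k<n. m k * (cmod (X $$ (k, j)))\<^sup>2)" using c(2) q by simp
  also have "\<dots> \<le> (\<Sum>k<n. mx * (cmod (X $$ (k, j)))\<^sup>2)"
    by (intro sum_mono mult_right_mono) (auto simp: mx_def)
  also have "\<dots> = mx" by (simp add: sum_distrib_left[symmetric] unitary_column_sum[OF X j])
  finally have "c powr s \<le> mx powr s" using c(1) s by (intro powr_mono2) auto
  also have "\<dots> = (\<Sum>i\<in>{k}. m i powr s)" using k by simp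
  also have "\<dots> \<le> (\<Sum>i<n. m i powr s)" by (rule sum_mono2) (use k in auto)
  also have "\<dots> = re_trace (mat_powr M s)" by (rule re_trace_eig[OF eig_powr[OF e], symmetric])
  finally show ?thesis .
qed

text \<open>The first column has entries of equal modulus, so conjugating a diagonal matrix puts the
  plain average of its diagonal in the corner (0, 0).\<close>

definition hadamard :: "complex mat" where
  "hadamard = mat 2 2 (\<lambda>(i, j). complex_of_real (if i = 1 \<and> j = 1 then - (1 / sqrt 2) else 1 / sqrt 2))"

lemma hadamard_unitary: "unitary_mat 2 hadamard"
proof (rule unitaryI)
  show "hadamard \<in> carrier_mat 2 2" by (simp add: hadamard_def)
  have s: "complex_of_real (sqrt 2) * complex_of_real (sqrt 2) = 2"
    by (metis of_real_mult of_real_numeral real_sqrt_mult_self abs_numeral)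
  show "mat_adjoint hadamard * hadamard = 1\<^sub>m 2"
  proof (rule eq_matI)
    fix i j assume "i < dim_row (1\<^sub>m 2 :: complex mat)" "j < dim_col (1\<^sub>m 2 :: complex mat)"
    then have ij: "i < 2" "j < 2" by auto
    have "(mat_adjoint hadamard * hadamard) $$ (i, j) = (\<Sum>k<2. mat_adjoint hadamard $$ (i, k) * hadamard $$ (k, j))"
      by (rule mult_index) (use ij in \<open>auto simp: hadamard_def\<close>)
    also have "\<dots> = 1\<^sub>m 2 $$ (i, j)"
      using ij s by (auto simp: hadamard_def numeral_2_eq_2 less_Suc_eq field_simps)
    finally show "(mat_adjoint hadamard * hadamard) $$ (i, j) = 1\<^sub>m 2 $$ (i, j)" .
  qed (auto simp: hadamard_def)
qed

text \<open>If \<open>p > 1\<close>, concavity fails on the segment between \<open>B = diag (1 + h, 1 - h)\<close> and its reflection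
  when \<open>A\<close> is close to the rank-one projection onto the first Hadamard vector: in the limit
  \<open>\<Phi>\<close> becomes a power of a strictly convex function.\<close>
lemma exponent_le_one:
  assumes jc: "jointly_concave_Phi 2 p q s" and q: "0 < q" and s: "0 < s"
  shows "p \<le> 1"
proof (rule ccontr)
  assume "\<not> p \<le> 1"
  then obtain h where h: "0 < h" "h < 1" "2 < (1 + h) powr p + (1 - h) powr p"
    using powr_strictly_convex_witness[of p] by auto
  \<comment> \<open>The quadratic form of B^p at the first Hadamard vector, the same for B and for
    its reflection.\<close>
  define c where "c = ((1 + h) powr p + (1 - h) powr p) / 2"
  have c: "1 < c" using h by (simp add: c_def)
  have cs: "1 < c powr s" using powr_less_mono2[of s 1 c] s c by simp
  \<comment> \<open>The second eigenvalue of A is tuned so that its contribution at the midpoint,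
    where B is the identity, uses up only half of the gap c^s - 1.\<close>
  define \<epsilon> where "\<epsilon> = ((c powr s - 1) / 2) powr (1 / (q * s))"
  have \<epsilon>: "0 < \<epsilon>" "\<epsilon> powr (q * s) = (c powr s - 1) / 2" using cs q s by (auto simp: \<epsilon>_def powr_powr)
  define d where "d i = (if i = 0 then 1 else \<epsilon>)" for i :: nat
  define V where "V = hadamard"
  have V: "unitary_mat 2 V" "V \<in> carrier_mat 2 2"
    using hadamard_unitary by (auto simp: V_def unitary_carrier)
  define A where "A = V * real_diag 2 d * mat_adjoint V"
  have eA: "eig 2 A V d" using V \<epsilon> by (simp add: eig_def A_def d_def)
  have A: "pos_def_mat 2 A" by (rule eig_pos_def[OF eA])
  have low: "c powr s \<le> Phi p q s A (real_diag 2 b)"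
    if b: "\<And>i. i < 2 \<Longrightarrow> 0 < b i" and bc: "b 0 powr p + b 1 powr p = 2 * c" for b
  proof -
    note eB = eig_real_diag[of 2 b, OF b]
    have B: "pos_def_mat 2 (real_diag 2 b)" by (rule pos_def_real_diag[OF b])
    define R where "R r = real_diag 2 (\<lambda>i. d i powr r)" for r
    define Bp where "Bp = real_diag 2 (\<lambda>i. b i powr p)"
    have Rc: "R r \<in> carrier_mat 2 2" "Bp \<in> carrier_mat 2 2" for r by (auto simp: R_def Bp_def)
    have Bp: "mat_powr (real_diag 2 b) p = Bp" using mat_powr_eig[OF eB] by (simp add: Bp_def)
    have Ar: "mat_powr A r = V * R r * mat_adjoint V" for r unfolding mat_powr_eig[OF eA] R_def ..
    define M where "M = mat_powr A (q/2) * Bp * mat_powr A (q/2)"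
    have M: "pos_def_mat 2 M"
      unfolding M_def Bp[symmetric]
      using pos_def_congr[OF pos_def_powr[OF B], of "mat_powr A (q/2)" "mat_powr A (-(q/2))"] A
      by (simp add: adj_powr[OF A] powr_mult_powr[OF A] powr_zero_mat[OF A])
    have "mat_adjoint V * M * V = R (q/2) * (mat_adjoint V * (Bp * V)) * R (q/2)"
      unfolding M_def Ar using V(2) Rc
      by (simp add: assoc3[of _ 2] carrier_mult cancel_left[of _ _ 2] right_mult_one_mat[of _ 2 2] unitary_left[OF V(1)])
    \<comment> \<open>Because d 0 = 1, the outer factors leave this entry alone, and the lower bound
      does not depend on \<open>\<epsilon>\<close>.\<close>
    also have "\<dots> $$ (0, 0) = (mat_adjoint V * (Bp * V)) $$ (0, 0)"
      unfolding R_def using V(2) Rc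
      by (simp add: mult_real_diag_index[of _ 2 2] real_diag_mult_index[of _ 2 2] carrier_mult d_def del: index_mult_mat(1))
    also have "\<dots> = (\<Sum>k<2. mat_adjoint V $$ (0, k) * (Bp * V) $$ (k, 0))"
      by (rule mult_index) (use V(2) Rc in \<open>auto simp: carrier_mult\<close>)
    also have "\<dots> = (\<Sum>k<2. complex_of_real (b k powr p / 2))"
    proof (intro sum.cong refl)
      fix k :: nat assume k: "k \<in> {..<2}"
      have "1 / sqrt 2 * (b k powr p * (1 / sqrt 2)) = b k powr p / 2" by simp
      then have e: "complex_of_real (1 / sqrt 2) * (complex_of_real (b k powr p) * complex_of_real (1 / sqrt 2)) = complex_of_real (b k powr p / 2)"
        by (metis of_real_mult)
      have v: "V $$ (k, 0) = complex_of_real (1 / sqrt 2)" using k by (simp add: V_def hadamard_def)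
      have "(Bp * V) $$ (k, 0) = complex_of_real (b k powr p) * V $$ (k, 0)"
        unfolding Bp_def by (rule real_diag_mult_index) (use V(2) k in auto)
      moreover have "mat_adjoint V $$ (0, k) = cnj (V $$ (k, 0))" using V(2) k by simp
      ultimately show "mat_adjoint V $$ (0, k) * (Bp * V) $$ (k, 0) = complex_of_real (b k powr p / 2)"
        unfolding v using e by simp
    qed
    also have "\<dots> = complex_of_real c" using bc by (simp add: numeral_2_eq_2 flip: of_real_add add_divide_distrib)
    finally have "Re ((mat_adjoint V * M * V) $$ (0, 0)) = c" by simp
    then have "c powr s \<le> re_trace (mat_powr M s)"
      using c by (intro re_trace_powr_lower_bound[OF M V(1) _ s, of 0]) auto
    then show ?thesis by (simp add: Phi_def re_trace_def M_def Bp)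
  qed
  define b1 where "b1 i = (if i = 0 then 1 + h else 1 - h)" for i :: nat
  define b2 where "b2 i = (if i = 0 then 1 - h else 1 + h)" for i :: nat
  have b1: "0 < b1 i" and b2: "0 < b2 i" for i using h by (auto simp: b1_def b2_def)
  have "mix (1/2) (real_diag 2 b1) (real_diag 2 b2) = real_diag 2 (\<lambda>_. 1)"
    unfolding mix_real_diag by (rule real_diag_cong) (auto simp: b1_def b2_def field_simps)
  moreover have "mix (1/2) A A = A" by (rule mix_same[OF pos_def_carrier[OF A]])
  moreover have "Phi p q s A (real_diag 2 (\<lambda>_. 1)) = 1 + \<epsilon> powr (q * s)"
  proof -
    have "mat_powr (real_diag 2 (\<lambda>_. 1)) p = 1\<^sub>m 2"
      using mat_powr_eig[OF eig_real_diag[of 2 "\<lambda>_. 1"], of p] by (simp add: real_diag_one)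
    then have "Phi p q s A (real_diag 2 (\<lambda>_. 1)) = re_trace (mat_powr A (q * s))"
      by (simp add: Phi_def re_trace_def right_mult_one_mat[OF powr_carrier[OF A]] powr_mult_powr[OF A] powr_powr_mat[OF A])
    also have "\<dots> = 1 + \<epsilon> powr (q * s)"
      unfolding re_trace_eig[OF eig_powr[OF eA]] by (simp add: d_def numeral_2_eq_2)
    finally show ?thesis .
  qed
  moreover have "1/2 * Phi p q s A (real_diag 2 b1) + (1 - 1/2) * Phi p q s A (real_diag 2 b2)
    \<le> Phi p q s (mix (1/2) A A) (mix (1/2) (real_diag 2 b1) (real_diag 2 b2))"
    by (rule jointly_concave_PhiD[OF jc A _ A]) (use b1 b2 in \<open>auto intro: pos_def_real_diag\<close>)
  moreover have "c powr s \<le> Phi p q s A (real_diag 2 b1)" by (rule low) (use b1 in \<open>auto simp: b1_def c_def\<close>)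
  moreover have "c powr s \<le> Phi p q s A (real_diag 2 b2)" by (rule low) (use b2 in \<open>auto simp: b2_def c_def\<close>)
  ultimately have "c powr s \<le> 1 + (c powr s - 1) / 2" using \<epsilon>(2) by simp
  then have "c powr s * 2 \<le> 2 + (c powr s - 1)" by argo
  then show False using cs by argo
qed

theorem theorem4p3:
  fixes p q s :: real
  assumes "p \<noteq> 0" and "q \<noteq> 0" and "0 < s"
  shows "(\<forall>n. jointly_concave_Phi n p q s) \<longleftrightarrow>
           (0 < p \<and> p \<le> 1 \<and> 0 < q \<and> q \<le> 1 \<and> s \<le> 1 / (p + q))"
proof
  assume jc: "\<forall>n. jointly_concave_Phi n p q s"
  \<comment> \<open>The positivity test concerns q and the 2-by-2 test concerns p; exchanging the
    two matrices supplies the remaining bounds.\<close>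
  then have jc': "jointly_concave_Phi n q p s" for n by (simp add: jointly_concave_Phi_swap)
  have q: "0 < q" using scalar_exponent_pos assms jc by blast
  have p: "0 < p" using scalar_exponent_pos assms jc' by blast
  show "0 < p \<and> p \<le> 1 \<and> 0 < q \<and> q \<le> 1 \<and> s \<le> 1 / (p + q)"
    using p q scalar_exponent_sum exponent_le_one jc jc' assms(3) by blast
next
  assume "0 < p \<and> p \<le> 1 \<and> 0 < q \<and> q \<le> 1 \<and> s \<le> 1 / (p + q)"
  then show "\<forall>n. jointly_concave_Phi n p q s"
    using jointly_concave_Phi_sufficient assms(3) by simp
qed

end
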